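(* Let $p\in[2,\infty]$ and let $q$ be its conjugate exponent, $\frac1p+\frac1q=1$ (so $q=1$ if $p=\infty$). Let $\|\cdot\|$ be an arbitrary norm on $\mathbb{R}^d$ with dual norm $\|\cdot\|_*$, and let $W_p$ be the $p$-Wasserstein distance on probability measures on $\mathbb{R}^d$ built from $\|\cdot\|$. Let $\mu_0$, $f,\Phi,\ell$, $\Theta_0$, $\Theta$, $j$ and $J$ be as in the context, satisfying assumptions (i)-(iii) listed there. Then $$\sup_{\tilde\mu:\,W_p(\mu_0,\tilde\mu)\le\delta} J(\tilde\mu,\theta)\;=\;J(\mu_0,\theta)+\delta\left(\mathbb{E}_{x\sim\mu_0}\left[\|\nabla_x j(x,\theta)\|_*^q\right]\right)^{1/q}+O(\delta^2),$$ where the $O(\delta^2)$ term is uniform over all $\theta\in\Theta$. In particular, $$V_\delta^*-U_\delta^*=O(\delta^2),$$ where $$V_\delta^*=\inf_{\theta\in\Theta}\ \sup_{\tilde\mu:\,W_p(\mu_0,\tilde\mu)\le\delta} J(\tilde\mu,\theta),\qquad U_\delta^*=\inf_{\theta\in\Theta}\left\{J(\mu_0,\theta)+\delta\left(\mathbb{E}_{x\sim\mu_0}\left[\|\nabla_x j(x,\theta)\|_*^q\right]\right)^{1/q}\right\}.$$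
   Context: Setting. Fix $T>0$, a parameter set $\Theta_0$, and functions $f:\mathbb{R}^d\times\Theta_0\to\mathbb{R}^d$, $\Phi:\mathbb{R}^d\times\Theta_0\to\mathbb{R}$, $\ell:\mathbb{R}^d\times\Theta_0\to\mathbb{R}$, whose variables are written $(\xi,\vartheta)$. $\Theta$ is a given family of controls $\theta:[0,T]\to\Theta_0$. For $\theta\in\Theta$ and $x\in\mathbb{R}^d$, $X_{x,\cdot}$ denotes the solution of $\dot X_{x,t}=f(X_{x,t},\theta_t)$, $t\in(0,T)$, $X_{x,0}=x$. Define $$j(x,\theta)=\ell(X_{x,T},\theta_T)+\int_0^T\Phi(X_{x,t},\theta_t)\,dt,\qquad J(\mu,\theta)=\mathbb{E}_{x\sim\mu}[j(x,\theta)]$$ for a probability measure $\mu$ on $\mathbb{R}^d$. Wasserstein distance. With $\Gamma(\mu,\tilde\mu)$ the set of couplings of $\mu$ and $\tilde\mu$, $W_p(\mu,\tilde\mu)=\inf_{\pi\in\Gamma(\mu,\tilde\mu)}\left(\int\|x-\tilde x\|^p\,d\pi(x,\tilde x)\right)^{1/p}$ for $p<\infty$, and $W_\infty(\mu,\tilde\mu)=\min_{\pi\in\Gamma(\mu,\tilde\mu)}\operatorname{ess\,sup}_\pi\|x-\tilde x\|$. Assumptions. (i) $f$ is bounded; $f,\Phi$ are continuous in $\vartheta$; $f,\Phi,\ell$ are continuously differentiable in $\xi$, with first derivatives Lipschitz continuous in $\xi$ uniformly in $\vartheta$; $\ell$ is continuously differentiable in $\vartheta$. (ii) $\mu_0$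 is a probability measure on $\mathbb{R}^d$ with bounded support. (iii) $f,\Phi,\ell$ are twice continuously differentiable in $\xi$.
   Formalization: Added assumption: the gradients of Φ and ℓ in ξ at ξ=0 are bounded over Θ_0 (automatic for compact Θ_0). Without it the uniformity in θ fails, e.g. f=sin ξ, Φ=0, ℓ=ϑξ, Θ_0=ℝ, constant controls, μ_0 a point mass, p=∞. *)

theory Defs
  imports "HOL-Probability.Probability"
begin

section \<open>Norms and gradients\<close>

definition is_norm :: "('a::real_vector \<Rightarrow> real) \<Rightarrow> bool" where
  "is_norm N \<longleftrightarrow>
     (\<forall>x. 0 \<le> N x) \<and> (\<forall>x. N x = 0 \<longleftrightarrow> x = 0) \<and>
     (\<forall>c x. N (c *\<^sub>R x) = \<bar>c\<bar> * N x) \<and>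
     (\<forall>x y. N (x + y) \<le> N x + N y)"

definition dual_norm :: "('a::real_inner \<Rightarrow> real) \<Rightarrow> 'a \<Rightarrow> real" where
  "dual_norm N y = (SUP x\<in>{x. N x \<le> 1}. x \<bullet> y)"

definition gradient :: "('a::real_inner \<Rightarrow> real) \<Rightarrow> 'a \<Rightarrow> 'a" where
  "gradient g x = (THE D. GDERIV g x :> D)"


section \<open>Smoothness classes\<close>

text \<open>On a set that is not open (a general parameter set), the derivative is taken within the set
  and is only required to exist and to admit a continuous choice.\<close>

definition C1_on :: "'a::real_normed_vector set \<Rightarrow> ('a \<Rightarrow> 'b::real_normed_vector) \<Rightarrow> bool" where
  "C1_on S g \<longleftrightarrow>
     (\<exists>D :: 'a \<Rightarrow> 'a \<Rightarrow>\<^sub>L 'b.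
        (\<forall>x\<in>S. (g has_derivative blinfun_apply (D x)) (at x within S)) \<and> continuous_on S D)"

definition C2_on :: "'a::real_normed_vector set \<Rightarrow> ('a \<Rightarrow> 'b::real_normed_vector) \<Rightarrow> bool" where
  "C2_on S g \<longleftrightarrow>
     (\<exists>D :: 'a \<Rightarrow> 'a \<Rightarrow>\<^sub>L 'b.
        (\<forall>x\<in>S. (g has_derivative blinfun_apply (D x)) (at x within S)) \<and> C1_on S D)"

text \<open>Continuous differentiability in the first variable, with first derivatives Lipschitz in that
  variable uniformly over the second: the constant \<open>L\<close> is chosen before the parameter.\<close>

definition uniformly_C1_Lipschitz ::
    "'m set \<Rightarrow> ('a::real_normed_vector \<Rightarrow> 'm \<Rightarrow> 'b::real_normed_vector) \<Rightarrow> bool" where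
  "uniformly_C1_Lipschitz \<Theta>\<^sub>0 g \<longleftrightarrow>
     (\<exists>L. \<forall>u\<in>\<Theta>\<^sub>0. \<exists>D :: 'a \<Rightarrow> 'a \<Rightarrow>\<^sub>L 'b.
        (\<forall>\<xi>. ((\<lambda>\<xi>. g \<xi> u) has_derivative blinfun_apply (D \<xi>)) (at \<xi>)) \<and>
        L-lipschitz_on UNIV D)"


section \<open>Wasserstein distances\<close>

definition borel_prob :: "'a::topological_space measure \<Rightarrow> bool" where
  "borel_prob \<mu> \<longleftrightarrow> prob_space \<mu> \<and> sets \<mu> = sets borel"

definition measure_support :: "'a::topological_space measure \<Rightarrow> 'a set" where
  "measure_support \<mu> = {x. \<forall>U. open U \<and> x \<in> U \<longrightarrow> 0 < emeasure \<mu> U}"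

definition couplings ::
    "'a::topological_space measure \<Rightarrow> 'a measure \<Rightarrow> ('a \<times> 'a) measure set" where
  "couplings \<mu> \<nu> =
     {\<pi>. sets \<pi> = sets (borel \<Otimes>\<^sub>M borel) \<and> distr \<pi> borel fst = \<mu> \<and> distr \<pi> borel snd = \<nu>}"

definition Lp_seminorm :: "ennreal \<Rightarrow> 'b measure \<Rightarrow> ('b \<Rightarrow> real) \<Rightarrow> ennreal" where
  "Lp_seminorm p M g =
     (if p = \<infinity> then esssup M (\<lambda>z. ennreal \<bar>g z\<bar>)
      else let I = (\<integral>\<^sup>+ z. ennreal (\<bar>g z\<bar> powr enn2real p) \<partial>M)
           in if I = \<infinity> then \<infinity> else ennreal (enn2real I powr (1 / enn2real p)))"

text \<open>The value is \<open>\<infinity>\<close> when no coupling has finite cost. For \<open>p = \<infinity>\<close> the infimum is attained,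
  so it agrees with the usual definition by a minimum.\<close>

definition wasserstein ::
    "ennreal \<Rightarrow> ('a::real_normed_vector \<Rightarrow> real) \<Rightarrow> 'a measure \<Rightarrow> 'a measure \<Rightarrow> ennreal" where
  "wasserstein p N \<mu> \<nu> = (INF \<pi>\<in>couplings \<mu> \<nu>. Lp_seminorm p \<pi> (\<lambda>(x, y). N (x - y)))"

definition wasserstein_ball ::
    "ennreal \<Rightarrow> ('a::real_normed_vector \<Rightarrow> real) \<Rightarrow> 'a measure \<Rightarrow> real \<Rightarrow> 'a measure set" where
  "wasserstein_ball p N \<mu> \<delta> = {\<nu>. borel_prob \<nu> \<and> wasserstein p N \<mu> \<nu> \<le> ennreal \<delta>}"


section \<open>The control problem\<close>

text \<open>Controls are merely measurable in time, so the differential equation is understood in the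
  sense of Caratheodory, that is, in integrated form.\<close>

definition ode_solution ::
    "real \<Rightarrow> ('a::euclidean_space \<Rightarrow> 'm \<Rightarrow> 'a) \<Rightarrow> (real \<Rightarrow> 'm) \<Rightarrow> 'a \<Rightarrow> (real \<Rightarrow> 'a) \<Rightarrow> bool" where
  "ode_solution T f \<theta> x X \<longleftrightarrow>
     continuous_on {0..T} X \<and>
     set_integrable lebesgue {0..T} (\<lambda>s. f (X s) (\<theta> s)) \<and>
     (\<forall>t\<in>{0..T}. X t = x + (LINT s:{0..t}|lebesgue. f (X s) (\<theta> s)))"

text \<open>Here \<open>X \<theta> x t\<close> is the state at time \<open>t\<close> under the control \<open>\<theta>\<close>, started at \<open>x\<close>.\<close>

definition cost ::
    "real \<Rightarrow> ('a \<Rightarrow> 'm \<Rightarrow> real) \<Rightarrow> ('a \<Rightarrow> 'm \<Rightarrow> real) \<Rightarrow> ((real \<Rightarrow> 'm) \<Rightarrow> 'a \<Rightarrow> real \<Rightarrow> 'a) \<Rightarrow>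
     'a \<Rightarrow> (real \<Rightarrow> 'm) \<Rightarrow> real" where
  "cost T \<Phi> \<l> X x \<theta> =
     \<l> (X \<theta> x T) (\<theta> T) + (LINT t:{0..T}|lebesgue. \<Phi> (X \<theta> x t) (\<theta> t))"

definition expected_cost :: "('a \<Rightarrow> 'c \<Rightarrow> real) \<Rightarrow> 'a measure \<Rightarrow> 'c \<Rightarrow> real" where
  "expected_cost j \<mu> \<theta> = (\<integral>x. j x \<theta> \<partial>\<mu>)"

definition worst_case_cost ::
    "ennreal \<Rightarrow> ('a::real_normed_vector \<Rightarrow> real) \<Rightarrow> ('a \<Rightarrow> 'c \<Rightarrow> real) \<Rightarrow> 'a measure \<Rightarrow> real \<Rightarrow> 'c
     \<Rightarrow> ereal" where
  "worst_case_cost p N j \<mu> \<delta> \<theta> =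
     (SUP \<nu>\<in>wasserstein_ball p N \<mu> \<delta>. ereal (expected_cost j \<nu> \<theta>))"

definition first_order_cost ::
    "ennreal \<Rightarrow> ('a::real_inner \<Rightarrow> real) \<Rightarrow> ('a \<Rightarrow> 'c \<Rightarrow> real) \<Rightarrow> 'a measure \<Rightarrow> real \<Rightarrow> 'c
     \<Rightarrow> real" where
  "first_order_cost q N j \<mu> \<delta> \<theta> =
     expected_cost j \<mu> \<theta> +
     \<delta> * (\<integral>x. dual_norm N (gradient (\<lambda>x. j x \<theta>) x) powr enn2real q \<partial>\<mu>) powr (1 / enn2real q)"

text \<open>Extended real values, because the infima over controls may be \<open>-\<infinity>\<close>.\<close>

definition robust_value ::
    "ennreal \<Rightarrow> ('a::real_normed_vector \<Rightarrow> real) \<Rightarrow> ('a \<Rightarrow> 'c \<Rightarrow> real) \<Rightarrow> 'a measure \<Rightarrow> 'c set \<Rightarrow> real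
     \<Rightarrow> ereal" where
  "robust_value p N j \<mu> \<Theta> \<delta> = (INF \<theta>\<in>\<Theta>. worst_case_cost p N j \<mu> \<delta> \<theta>)"

definition first_order_value ::
    "ennreal \<Rightarrow> ('a::real_inner \<Rightarrow> real) \<Rightarrow> ('a \<Rightarrow> 'c \<Rightarrow> real) \<Rightarrow> 'a measure \<Rightarrow> 'c set \<Rightarrow> real
     \<Rightarrow> ereal" where
  "first_order_value q N j \<mu> \<Theta> \<delta> = (INF \<theta>\<in>\<Theta>. ereal (first_order_cost q N j \<mu> \<delta> \<theta>))"

text \<open>The bound \<open>\<bar>a - b\<bar> \<le> e\<close> in a form that does not involve \<open>\<infinity> - \<infinity>\<close>:
  for finite \<open>a\<close> and \<open>b\<close> it is that bound, and an infinite value is close only to itself.\<close>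

definition ereal_close :: "real \<Rightarrow> ereal \<Rightarrow> ereal \<Rightarrow> bool" where
  "ereal_close e a b \<longleftrightarrow> a \<le> b + ereal e \<and> b \<le> a + ereal e"

end

theory Submission
  imports Defs
begin

text \<open>Gronwall's inequality bounds the convexity defect of the flow in its initial value to second
  order, since \<open>f\<close> has bounded and Lipschitz derivatives. The cost inherits this bound, which alone
  forces it to be differentiable with a quadratic Taylor remainder; no variational equation is
  needed. For initial points in a ball the remainder constant is uniform over all end points and all
  controls. Integrating the Taylor expansion against a transport plan, Hoelder's inequality and
  \<open>p \<ge> 2\<close> give the upper bound. For the lower bound, \<open>\<mu>\<^sub>0\<close> is pushed along a measurable, nearly
  optimal direction for the dual norm, with step lengths from the equality case of Hoelder's
  inequality.\<close>

section \<open>Second-order analysis without second derivatives\<close>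

text \<open>The controls are only measurable in time, so a derivative of the flow in its initial
  value would have to be built from a linear equation with measurable coefficients and then shown to
  be Lipschitz. The defect \<open>(1 - s) * g a + s * g b - g ((1 - s) *\<^sub>R a + s *\<^sub>R
  b)\<close> can be stated without any derivative of \<open>g\<close>, and bounds on it pass with
  explicit constants through composition with functions that have Lipschitz derivatives and through
  integration in time. It vanishes exactly for affine \<open>g\<close>, which is why a quadratic
  bound yields an affine approximation. The starting points must lie in a ball because the
  derivatives of \<open>\<Phi>\<close> and \<open>\<l>\<close> are bounded uniformly in the
  parameter only at 0 and may grow linearly from there. The end points cannot be confined: for
  finite \<open>p\<close> a measure in the Wasserstein ball may have unbounded support. The
  condition \<open>p \<ge> 2\<close> is what makes the quadratic remainder integrable: a transport
  cost of at most \<delta> bounds the second moment of the displacement by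
  \<open>\<delta>\<^sup>2\<close>.\<close>

lemma geometric_telescope_limit:
  fixes d :: "nat \<Rightarrow> real"
  assumes d: "\<And>n. \<bar>d (Suc n) - d n\<bar> \<le> c * (1/2)^n"
  obtains l where "d \<longlonglongrightarrow> l" "\<bar>l - d 0\<bar> \<le> 2 * c"
proof -
  have g: "(\<lambda>n. c * (1/2::real)^n) sums (c * 2)"
    using sums_mult[OF geometric_sums[of "1/2::real"], of c] by simp
  have sm: "summable (\<lambda>n. d (Suc n) - d n)"
    by (rule summable_comparison_test[OF _ sums_summable[OF g]]) (use d in auto)
  have "(\<lambda>n. d 0 + (\<Sum>i<n. d (Suc i) - d i)) \<longlonglongrightarrow> d 0 + (\<Sum>n. d (Suc n) - d n)"
    by (intro tendsto_add tendsto_const summable_LIMSEQ sm)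
  then obtain l where l: "d \<longlonglongrightarrow> l" by (auto simp: sum_lessThan_telescope)
  have "l - d 0 = (\<Sum>n. d (Suc n) - d n)"
    using telescope_sums[OF l] by (simp add: sums_iff)
  also have "\<bar>\<dots>\<bar> \<le> c * 2"
    using norm_suminf_le[OF _ sums_summable[OF g], of "\<lambda>n. d (Suc n) - d n"] d sums_unique[OF g] by simp
  finally show thesis using l that by simp
qed

text \<open>The mean value inequality for \<open>F\<close> minus its linearization at
  \<open>x\<close>. It uses the largest deviation of \<open>D\<close> from \<open>D x\<close> on the
  segment, hence the constant \<open>L\<close> in place of the sharp \<open>L / 2\<close>; no
  integral in the target space is involved.\<close>

lemma derivative_Lipschitz_remainder:
  fixes F :: "'a::real_normed_vector \<Rightarrow> 'b::real_normed_vector" and D :: "'a \<Rightarrow> 'a \<Rightarrow>\<^sub>L 'b"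
  assumes F: "\<And>x. (F has_derivative blinfun_apply (D x)) (at x)" and D: "L-lipschitz_on UNIV D"
  shows "norm (F y - F x - D x (y - x)) \<le> L * (norm (y - x))\<^sup>2"
proof -
  have L: "0 \<le> L" using D by (rule lipschitz_on_nonneg)
  have "norm (F y - F x - blinfun_apply (D x) (y - x)) \<le> norm (y - x) * (L * norm (y - x))"
  proof (rule differentiable_bound_linearization[where S = "closed_segment x y"])
    fix z assume z: "z \<in> closed_segment x y"
    show "(F has_derivative blinfun_apply (D z)) (at z within closed_segment x y)"
      using F has_derivative_at_withinI by blast
    have "onorm (blinfun_apply (D z) - blinfun_apply (D x)) = norm (D z - D x)"
      by (transfer) (auto simp: fun_diff_def)
    also have "\<dots> \<le> L * norm (z - x)"
      using lipschitz_onD[OF D, of z x] by (simp add: dist_norm)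
    also have "\<dots> \<le> L * norm (y - x)"
      using z L by (intro mult_left_mono) (auto simp: segment_bound1)
    finally show "onorm (blinfun_apply (D z) - blinfun_apply (D x)) \<le> L * norm (y - x)" .
  next
    fix t :: real assume "t \<in> {0..1}"
    then show "x + t *\<^sub>R (y - x) \<in> closed_segment x y"
      unfolding in_segment by (intro exI[of _ t]) (auto simp: algebra_simps)
  qed simp
  then show ?thesis by (simp add: power2_eq_square mult_ac)
qed

text \<open>All three values are expanded at a common base point \<open>x\<close>: the constant
  terms cancel, the linear terms combine to \<open>D x\<close> applied to the defect of the
  arguments, and only remainders are left. The point \<open>c\<close> is free because it will be the
  flow of a convex combination, which is not the convex combination of the flows.\<close>

lemma convex_combination_deviation:
  fixes F :: "'a::real_normed_vector \<Rightarrow> 'b::real_normed_vector" and D :: "'a \<Rightarrow> 'a \<Rightarrow>\<^sub>L 'b"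
  assumes F: "\<And>x. (F has_derivative blinfun_apply (D x)) (at x)" and D: "L-lipschitz_on UNIV D"
    and s: "s \<in> {0..1}"
  shows "norm ((1 - s) *\<^sub>R F a + s *\<^sub>R F b - F c)
      \<le> norm (D x) * norm ((1 - s) *\<^sub>R a + s *\<^sub>R b - c)
        + L * ((norm (a - x))\<^sup>2 + (norm (b - x))\<^sup>2 + (norm (c - x))\<^sup>2)"
proof -
  define r where "r y = F y - F x - D x (y - x)" for y
  have r: "norm (r y) \<le> L * (norm (y - x))\<^sup>2" for y
    unfolding r_def by (rule derivative_Lipschitz_remainder[OF F D])
  have "(1 - s) *\<^sub>R F a + s *\<^sub>R F b - F c
      = D x ((1 - s) *\<^sub>R a + s *\<^sub>R b - c) + (1 - s) *\<^sub>R r a + s *\<^sub>R r b - r c"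
    unfolding r_def by (simp add: blinfun.bilinear_simps algebra_simps)
  also have "norm \<dots> \<le> norm (D x ((1 - s) *\<^sub>R a + s *\<^sub>R b - c)) + norm ((1 - s) *\<^sub>R r a)
      + norm (s *\<^sub>R r b) + norm (r c)"
    by (meson add_mono norm_triangle_ineq norm_triangle_ineq4 order_trans order_refl)
  also have "norm (D x ((1 - s) *\<^sub>R a + s *\<^sub>R b - c)) \<le> norm (D x) * norm ((1 - s) *\<^sub>R a + s *\<^sub>R b - c)"
    by (rule norm_blinfun)
  also have "norm ((1 - s) *\<^sub>R r a) \<le> norm (r a)" using s by (simp add: mult_left_le_one_le)
  also have "norm (s *\<^sub>R r b) \<le> norm (r b)" using s by (simp add: mult_left_le_one_le)
  finally show ?thesis using r[of a] r[of b] r[of c] by (simp add: algebra_simps)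
qed

text \<open>In a unit direction \<open>h\<close>, the derivative is the increment
  \<open>F (x + h) - F x\<close>, at most \<open>2 * B\<close>, minus a remainder of at most
  \<open>L\<close>. This is how boundedness of \<open>f\<close> produces the Lipschitz constant that
  Gronwall's inequality requires.\<close>

lemma bounded_Lipschitz_derivative_bound:
  fixes F :: "'a::real_normed_vector \<Rightarrow> 'b::real_normed_vector" and D :: "'a \<Rightarrow> 'a \<Rightarrow>\<^sub>L 'b"
  assumes F: "\<And>x. (F has_derivative blinfun_apply (D x)) (at x)" and D: "L-lipschitz_on UNIV D"
    and B: "\<And>x. norm (F x) \<le> B"
  shows "norm (D x) \<le> 2 * B + L"
proof -
  have L: "0 \<le> L" using D by (rule lipschitz_on_nonneg)
  have B0: "0 \<le> B" using B[of undefined] norm_ge_zero order_trans by blast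
  have 1: "norm (D x h) \<le> 2 * B + L" if h: "norm h = 1" for h
  proof -
    have "norm (F (x + h) - F x - D x h) \<le> L"
      using derivative_Lipschitz_remainder[OF F D, of "x + h" x] h by simp
    moreover have "D x h = (F (x + h) - F x) - (F (x + h) - F x - D x h)" by simp
    ultimately show ?thesis using B[of "x + h"] B[of x]
      by (smt (verit) norm_triangle_ineq4)
  qed
  show ?thesis
  proof (rule norm_blinfun_bound)
    show "norm (D x h) \<le> (2 * B + L) * norm h" for h
    proof (cases "h = 0")
      case False
      have "norm (D x h) = norm h * norm (D x ((1 / norm h) *\<^sub>R h))"
        using False by (simp add: blinfun.bilinear_simps)
      also have "\<dots> \<le> norm h * (2 * B + L)" using False by (intro mult_left_mono 1) auto
      finally show ?thesis by (simp add: mult_ac)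
    qed simp
  qed (use B0 L in simp)
qed

text \<open>The weighted function \<open>u t * exp (- (2 * K * t))\<close> attains its maximum
  \<open>M'\<close> at some \<open>m\<close>. Inserting the resulting bound on \<open>u\<close> into
  the integral inequality at \<open>m\<close> lets half of \<open>M'\<close> be absorbed on the
  left. The weight \<open>2 * K\<close>, twice the usual rate, is what leaves this half, and it
  accounts for both factors 2 in the result.\<close>

lemma Gronwall:
  fixes u :: "real \<Rightarrow> real"
  assumes K: "0 < K" and T: "0 \<le> T" and al: "0 \<le> \<alpha>"
    and cont: "continuous_on {0..T} u"
    and u: "\<And>t. t \<in> {0..T} \<Longrightarrow> u t \<le> \<alpha> + K * (LINT s:{0..t}|lebesgue. u s)"
    and t: "t \<in> {0..T}"
  shows "u t \<le> 2 * exp (2 * K * T) * \<alpha>"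
proof -
  have "continuous_on {0..T} (\<lambda>t. u t * exp (- (2 * K * t)))"
    by (intro continuous_intros cont)
  then obtain m where m: "m \<in> {0..T}"
      and M: "\<And>t. t \<in> {0..T} \<Longrightarrow> u t * exp (- (2 * K * t)) \<le> u m * exp (- (2 * K * m))"
    using continuous_attains_sup[of "{0..T}" "\<lambda>t. u t * exp (- (2 * K * t))"] T by auto
  define M' where "M' = u m * exp (- (2 * K * m))"
  have ub: "u t \<le> M' * exp (2 * K * t)" if "t \<in> {0..T}" for t
    using M[OF that] unfolding M'_def[symmetric] by (simp add: exp_minus field_simps)
  have M'2: "M' \<le> 2 * \<alpha>"
  proof (cases "M' \<le> 0")
    case False
    have sub: "{0..m} \<subseteq> {0..T}" using m by auto
    have hi: "((\<lambda>s. M' * exp (2 * K * s)) has_integral (M' * (exp (2 * K * m) - 1) / (2 * K))) {0..m}"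
    proof -
      have "((\<lambda>s. M' * exp (2 * K * s)) has_integral
          (M' * exp (2 * K * m) / (2 * K) - M' * exp (2 * K * 0) / (2 * K))) {0..m}"
        by (rule fundamental_theorem_of_calculus)
          (use m K in \<open>auto intro!: derivative_eq_intros simp flip: has_real_derivative_iff_has_vector_derivative\<close>)
      then show ?thesis by (simp add: diff_divide_distrib right_diff_distrib)
    qed
    have si: "set_integrable lebesgue {0..m} g" if "continuous_on {0..m} g" for g :: "real \<Rightarrow> real"
      using that by (meson absolutely_integrable_continuous_real)
    have ce: "continuous_on {0..m} (\<lambda>s. M' * exp (2 * K * s))" by (intro continuous_intros)
    have "(LINT s:{0..m}|lebesgue. u s) \<le> (LINT s:{0..m}|lebesgue. M' * exp (2 * K * s))"
      using sub ub by (intro set_integral_mono si ce continuous_on_subset[OF cont]) auto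
    also have "\<dots> = M' * (exp (2 * K * m) - 1) / (2 * K)"
      using set_lebesgue_integral_eq_integral(2)[OF si[OF ce]] integral_unique[OF hi] by (simp only:)
    finally have "u m \<le> \<alpha> + K * (M' * (exp (2 * K * m) - 1) / (2 * K))"
      using u[OF m] K by (smt (verit) mult_left_mono)
    then have "u m \<le> \<alpha> + M' * (exp (2 * K * m) - 1) / 2" using K by simp
    also have "u m = M' * exp (2 * K * m)" by (simp add: M'_def exp_minus)
    finally have "M' * exp (2 * K * m) \<le> 2 * \<alpha> - M'" by (simp add: field_simps)
    moreover have "0 \<le> M' * exp (2 * K * m)" using False by simp
    ultimately show ?thesis using False by linarith
  qed (use al in simp)
  have "u t \<le> M' * exp (2 * K * t)" by (rule ub[OF t])
  also have "\<dots> \<le> (2 * \<alpha>) * exp (2 * K * t)" using M'2 by (intro mult_right_mono) auto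
  also have "\<dots> \<le> (2 * \<alpha>) * exp (2 * K * T)" using al K t by (intro mult_left_mono) auto
  finally show ?thesis by (simp add: mult_ac)
qed

text \<open>The derivative is the limit of dyadic difference quotients, and it is linear because the
  convexity defect is of second order on every segment. The defect is measured from \<open>x\<close>, not from
  the segment, so that the remainder bound holds for all \<open>y\<close> even when \<open>C\<close> depends on \<open>x\<close>.\<close>

lemma gradient_of_nearly_affine:
  fixes g :: "'a::euclidean_space \<Rightarrow> real"
  assumes aff: "\<And>a b s. s \<in> {0..1} \<Longrightarrow>
      \<bar>(1 - s) * g a + s * g b - g ((1 - s) *\<^sub>R a + s *\<^sub>R b)\<bar> \<le> C * ((norm (a - x))\<^sup>2 + (norm (b - x))\<^sup>2)"
    and lip: "\<And>a. \<bar>g a - g x\<bar> \<le> C * (norm (a - x) + (norm (a - x))\<^sup>2)"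
  obtains A where "\<And>y. \<bar>g y - g x - A \<bullet> (y - x)\<bar> \<le> 4 * C * (norm (y - x))\<^sup>2" "norm A \<le> C" "GDERIV g x :> A"
proof -
  define d where "d h n = 2 ^ n * (g (x + (1/2) ^ n *\<^sub>R h) - g x)" for h :: 'a and n :: nat
  have pp: "2 ^ n * (1/2::real) ^ n = 1" for n by (simp add: power_one_over)
  \<comment> \<open>The hypothesis at the midpoint of \<open>x\<close> and
    \<open>x + (1/2) ^ n *\<^sub>R h\<close>: the defect carries \<open>(1/2) ^ n\<close> squared,
    the scaling by \<open>2 ^ Suc n\<close> uses up one of these factors, and the other one makes
    the increments summable.\<close>
  have step: "\<bar>d h (Suc n) - d h n\<bar> \<le> (2 * C * (norm h)\<^sup>2) * (1/2) ^ n" for h n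
  proof -
    have "\<bar>(1 - 1/2) * g x + 1/2 * g (x + (1/2) ^ n *\<^sub>R h) - g ((1 - 1/2) *\<^sub>R x + (1/2) *\<^sub>R (x + (1/2) ^ n *\<^sub>R h))\<bar>
        \<le> C * ((norm (x - x))\<^sup>2 + (norm ((x + (1/2) ^ n *\<^sub>R h) - x))\<^sup>2)"
      by (rule aff) simp
    also have "(1 - 1/2) *\<^sub>R x + (1/2) *\<^sub>R (x + (1/2) ^ n *\<^sub>R h) = x + (1/2) ^ Suc n *\<^sub>R h"
      by (simp add: scaleR_add_right scaleR_add_left[symmetric])
    finally have *: "\<bar>1/2 * g x + 1/2 * g (x + (1/2) ^ n *\<^sub>R h) - g (x + (1/2) ^ Suc n *\<^sub>R h)\<bar>
        \<le> C * ((1/2) ^ n * norm h)\<^sup>2" by simp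
    have "d h (Suc n) - d h n = - (2 ^ Suc n * (1/2 * g x + 1/2 * g (x + (1/2) ^ n *\<^sub>R h) - g (x + (1/2) ^ Suc n *\<^sub>R h)))"
      by (simp add: d_def algebra_simps)
    then have "\<bar>d h (Suc n) - d h n\<bar> = 2 ^ Suc n * \<bar>1/2 * g x + 1/2 * g (x + (1/2) ^ n *\<^sub>R h) - g (x + (1/2) ^ Suc n *\<^sub>R h)\<bar>"
      by (simp only: abs_minus_cancel abs_mult) simp
    also have "\<dots> \<le> 2 ^ Suc n * (C * ((1/2) ^ n * norm h)\<^sup>2)" using * by (intro mult_left_mono) auto
    also have "\<dots> = (2 ^ n * (1/2) ^ n) * (2 * C * (norm h)\<^sup>2) * (1/2) ^ n"
      by (simp only: power2_eq_square power_Suc mult_ac)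
    finally show ?thesis by (simp only: pp mult_1)
  qed
  have "\<exists>l. d h \<longlonglongrightarrow> l \<and> \<bar>l - d h 0\<bar> \<le> 2 * (2 * C * (norm h)\<^sup>2)" for h
    using geometric_telescope_limit[of "d h", OF step] by blast
  then obtain l where l: "\<And>h. d h \<longlonglongrightarrow> l h" and l0: "\<And>h. \<bar>l h - d h 0\<bar> \<le> 2 * (2 * C * (norm h)\<^sup>2)"
    by metis
  have half: "(\<lambda>n. c * (1/2::real) ^ n) \<longlonglongrightarrow> 0" for c
    by (intro tendsto_mult_right_zero LIMSEQ_power_zero) simp
  \<comment> \<open>The defect at scale \<open>(1/2) ^ n\<close> is quadratic in the scale, while
    the quotients divide by the scale only once, so the limit is exactly affine on segments.\<close>
  have conv: "l ((1 - s) *\<^sub>R h + s *\<^sub>R k) = (1 - s) * l h + s * l k" if s: "s \<in> {0..1}" for s h k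
  proof -
    have "\<bar>(1 - s) * d h n + s * d k n - d ((1 - s) *\<^sub>R h + s *\<^sub>R k) n\<bar> \<le> (C * ((norm h)\<^sup>2 + (norm k)\<^sup>2)) * (1/2) ^ n" for n
    proof -
      let ?e = "(1/2::real) ^ n"
      have "\<bar>(1 - s) * g (x + ?e *\<^sub>R h) + s * g (x + ?e *\<^sub>R k) - g ((1 - s) *\<^sub>R (x + ?e *\<^sub>R h) + s *\<^sub>R (x + ?e *\<^sub>R k))\<bar>
        \<le> C * ((norm ((x + ?e *\<^sub>R h) - x))\<^sup>2 + (norm ((x + ?e *\<^sub>R k) - x))\<^sup>2)"
        by (rule aff[OF s])
      also have "(1 - s) *\<^sub>R (x + ?e *\<^sub>R h) + s *\<^sub>R (x + ?e *\<^sub>R k) = x + ?e *\<^sub>R ((1 - s) *\<^sub>R h + s *\<^sub>R k)"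
        by (simp add: algebra_simps)
      finally have *: "\<bar>(1 - s) * g (x + ?e *\<^sub>R h) + s * g (x + ?e *\<^sub>R k) - g (x + ?e *\<^sub>R ((1 - s) *\<^sub>R h + s *\<^sub>R k))\<bar>
         \<le> C * ((norm h)\<^sup>2 + (norm k)\<^sup>2) * ?e\<^sup>2"
        by (simp add: power_mult_distrib algebra_simps)
      have "(1 - s) * d h n + s * d k n - d ((1 - s) *\<^sub>R h + s *\<^sub>R k) n
         = 2 ^ n * ((1 - s) * g (x + ?e *\<^sub>R h) + s * g (x + ?e *\<^sub>R k) - g (x + ?e *\<^sub>R ((1 - s) *\<^sub>R h + s *\<^sub>R k)))"
        by (simp add: d_def algebra_simps)
      then have "\<bar>(1 - s) * d h n + s * d k n - d ((1 - s) *\<^sub>R h + s *\<^sub>R k) n\<bar>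
         = 2 ^ n * \<bar>(1 - s) * g (x + ?e *\<^sub>R h) + s * g (x + ?e *\<^sub>R k) - g (x + ?e *\<^sub>R ((1 - s) *\<^sub>R h + s *\<^sub>R k))\<bar>"
        by (simp only: abs_mult) simp
      also have "\<dots> \<le> 2 ^ n * (C * ((norm h)\<^sup>2 + (norm k)\<^sup>2) * ?e\<^sup>2)" using * by (intro mult_left_mono) auto
      also have "\<dots> = (2 ^ n * ?e) * ((C * ((norm h)\<^sup>2 + (norm k)\<^sup>2)) * ?e)"
        by (simp only: power2_eq_square mult_ac)
      finally show ?thesis by (simp only: pp mult_1)
    qed
    then have "(\<lambda>n. (1 - s) * d h n + s * d k n - d ((1 - s) *\<^sub>R h + s *\<^sub>R k) n) \<longlonglongrightarrow> 0"
      by (intro Lim_null_comparison[OF _ half[of "C * ((norm h)\<^sup>2 + (norm k)\<^sup>2)"]]) auto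
    moreover have "(\<lambda>n. (1 - s) * d h n + s * d k n - d ((1 - s) *\<^sub>R h + s *\<^sub>R k) n)
        \<longlonglongrightarrow> (1 - s) * l h + s * l k - l ((1 - s) *\<^sub>R h + s *\<^sub>R k)"
      by (intro tendsto_intros l)
    ultimately show ?thesis using LIMSEQ_unique by fastforce
  qed
  have "d 0 = (\<lambda>n. 0)" by (rule ext) (simp add: d_def)
  then have z: "l 0 = 0" using l[of 0] by (simp add: tendsto_const_iff)
  \<comment> \<open>From affine on segments to linear: \<open>l 0 = 0\<close> gives homogeneity for
    factors in the unit interval, inverting the factor extends it to all nonnegative ones, midpoints
    then give additivity, and additivity gives the negative factors.\<close>
  have sc01: "l (s *\<^sub>R h) = s * l h" if "s \<in> {0..1}" for s h
    using conv[OF that, of 0 h] z by simp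
  have scpos: "l (s *\<^sub>R h) = s * l h" if "0 \<le> s" for s h
  proof (cases "s \<le> 1")
    case False
    then have "l ((1/s) *\<^sub>R (s *\<^sub>R h)) = (1/s) * l (s *\<^sub>R h)" by (intro sc01) auto
    then show ?thesis using False by (simp add: field_simps)
  qed (use that sc01 in auto)
  have add: "l (h + k) = l h + l k" for h k
  proof -
    have "l (2 *\<^sub>R ((1 - 1/2) *\<^sub>R h + (1/2) *\<^sub>R k)) = 2 * ((1 - 1/2) * l h + (1/2) * l k)"
      using scpos[of 2 "(1 - 1/2) *\<^sub>R h + (1/2) *\<^sub>R k"] conv[of "1/2" h k] by simp
    then show ?thesis by (simp add: algebra_simps)
  qed
  have lin: "linear l"
  proof (rule linearI)
    show "l (r *\<^sub>R h) = r *\<^sub>R l h" for r h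
    proof (cases "0 \<le> r")
      case False
      have "l (r *\<^sub>R h) + l ((- r) *\<^sub>R h) = 0" using add[of "r *\<^sub>R h" "(-r) *\<^sub>R h"] z by simp
      then show ?thesis using scpos[of "-r" h] False by simp
    qed (use scpos in auto)
  qed (rule add)
  define A where "A = (\<Sum>b\<in>Basis. l b *\<^sub>R b)"
  have A: "A \<bullet> h = l h" for h
  proof -
    have "l h = l (\<Sum>b\<in>Basis. (h \<bullet> b) *\<^sub>R b)" by (simp add: euclidean_representation)
    also have "\<dots> = (\<Sum>b\<in>Basis. (h \<bullet> b) * l b)" using lin by (simp add: linear_sum linear_scale)
    finally show ?thesis by (simp add: A_def inner_sum_left) (simp add: inner_commute mult.commute)
  qed
  \<comment> \<open>The quotient of index 0 is the undivided increment
    \<open>g (x + h) - g x\<close>, so its distance to the limit is already the Taylor remainder.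
    The 4 is the sum 2 of the geometric series times the factor 2 in \<open>step\<close>.\<close>
  have rem: "\<bar>g y - g x - A \<bullet> (y - x)\<bar> \<le> 4 * C * (norm (y - x))\<^sup>2" for y
    using l0[of "y - x"] unfolding A by (simp add: d_def)
  have "\<bar>l h\<bar> \<le> C * norm h" for h
  proof -
    have "(\<lambda>n. \<bar>d h n\<bar>) \<longlonglongrightarrow> \<bar>l h\<bar>" by (intro tendsto_intros l)
    moreover have "(\<lambda>n. C * norm h + (C * (norm h)\<^sup>2) * (1/2) ^ n) \<longlonglongrightarrow> C * norm h + 0"
      by (intro tendsto_intros half)
    moreover have "\<bar>d h n\<bar> \<le> C * norm h + (C * (norm h)\<^sup>2) * (1/2) ^ n" for n
    proof -
      have "\<bar>d h n\<bar> = 2 ^ n * \<bar>g (x + (1/2) ^ n *\<^sub>R h) - g x\<bar>" by (simp add: d_def abs_mult)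
      also have "\<dots> \<le> 2 ^ n * (C * ((1/2) ^ n * norm h + ((1/2) ^ n * norm h)\<^sup>2))"
        using lip[of "x + (1/2) ^ n *\<^sub>R h"] by (intro mult_left_mono) simp_all
      also have "\<dots> = (2 ^ n * (1/2) ^ n) * (C * norm h + (C * (norm h)\<^sup>2) * (1/2) ^ n)"
        by (simp only: power2_eq_square ring_distribs mult_ac)
      finally show ?thesis by (simp only: pp mult_1)
    qed
    ultimately show ?thesis by (metis (no_types, lifting) LIMSEQ_le add.right_neutral)
  qed
  \<comment> \<open>With \<open>h = A\<close> the bound reads
    \<open>A \<bullet> A \<le> C * norm A\<close>. If \<open>A = 0\<close>, the claim is
    \<open>0 \<le> C\<close>, which follows from \<open>lip\<close> at a point one basis vector away
    from \<open>x\<close>.\<close>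
  from this[of A] have nA: "norm A \<le> C"
    using lip[of "x + (SOME b. b \<in> Basis)"] by (cases "A = 0") (auto simp: A[symmetric] dot_square_norm power2_eq_square nonempty_Basis some_in_eq zero_le_mult_iff)
  have "((\<lambda>h. norm (g (x + h) - g x - h \<bullet> A) / norm h) \<longlongrightarrow> 0) (at 0)"
  proof (rule Lim_null_comparison)
    show "((\<lambda>h. 4 * C * norm h) \<longlongrightarrow> 0) (at 0)" by (auto intro!: tendsto_eq_intros)
    show "\<forall>\<^sub>F h in at 0. norm (norm (g (x + h) - g x - h \<bullet> A) / norm h) \<le> 4 * C * norm h"
      using rem[of "x + _"] by (auto simp: eventually_at_filter inner_commute divide_le_eq power2_eq_square mult_ac)
  qed
  then have "GDERIV g x :> A"
    unfolding gderiv_def has_derivative_at by (simp add: bounded_linear_inner_left)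
  with rem nA that show thesis by blast
qed

section \<open>The flow\<close>

text \<open>Serves two purposes: for the difference of two solutions \<open>c\<close> is 0 and
  \<open>y0\<close> is the difference of the initial values; for the convexity defect of the flow
  \<open>y0\<close> is 0 and \<open>c\<close> is the quadratic error of the linearization.\<close>

lemma integral_Gronwall:
  fixes y v :: "real \<Rightarrow> 'a::euclidean_space"
  assumes K: "0 < K" and c: "0 \<le> c"
    and cont: "continuous_on {0..T} y"
    and int: "set_integrable lebesgue {0..T} v"
    and y: "\<And>t. t \<in> {0..T} \<Longrightarrow> y t = y0 + (LINT s:{0..t}|lebesgue. v s)"
    and v: "\<And>t. t \<in> {0..T} \<Longrightarrow> norm (v t) \<le> K * norm (y t) + c"
    and t: "t \<in> {0..T}"
  shows "norm (y t) \<le> 2 * exp (2 * K * T) * (norm y0 + T * c)"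
proof (rule Gronwall[OF K _ _ _ _ t])
  show "0 \<le> T" using t by simp
  then show "0 \<le> norm y0 + T * c" using c by simp
  show cn: "continuous_on {0..T} (\<lambda>t. norm (y t))" by (intro continuous_intros cont)
  fix t assume t: "t \<in> {0..T}"
  then have sub: "{0..t} \<subseteq> {0..T}" by auto
  have iv: "set_integrable lebesgue {0..t} v" by (rule set_integrable_subset[OF int _ sub]) simp
  have iy: "set_integrable lebesgue {0..t} (\<lambda>s. norm (y s))"
    by (intro absolutely_integrable_continuous_real continuous_on_subset[OF cn sub])
  have ic: "set_integrable lebesgue {0..t} (\<lambda>s. c)"
    by (intro absolutely_integrable_continuous_real continuous_intros)
  have "norm (LINT s:{0..t}|lebesgue. v s) \<le> (LINT s:{0..t}|lebesgue. norm (v s))"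
    using integral_norm_bound[of lebesgue "\<lambda>s. indicator {0..t} s *\<^sub>R v s"]
    by (simp add: set_lebesgue_integral_def)
  also have "\<dots> \<le> (LINT s:{0..t}|lebesgue. K * norm (y s) + c)"
    using v sub by (intro set_integral_mono set_integral_add set_integrable_mult_right iy ic set_integrable_norm iv) auto
  also have "\<dots> = K * (LINT s:{0..t}|lebesgue. norm (y s)) + (LINT s:{0..t}|lebesgue. c)"
    using iy ic by (subst set_integral_add) auto
  also have "(LINT s:{0..t}|lebesgue. c) = t * c"
    using t by (simp add: set_lebesgue_integral_def)
  also have "t * c \<le> T * c" using t c by (intro mult_right_mono) auto
  finally show "norm (y t) \<le> norm y0 + T * c + K * (LINT s:{0..t}|lebesgue. norm (y s))"
    using norm_triangle_ineq[of y0 "LINT s:{0..t}|lebesgue. v s"] y[OF t] by simp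
qed

text \<open>The bound does not depend on the initial point or the control, so trajectories that
  start in a ball remain in one slightly larger ball.\<close>

lemma ode_solution_displacement:
  assumes "ode_solution T f \<theta> x X" "\<And>\<xi> t. t \<in> {0..T} \<Longrightarrow> norm (f \<xi> (\<theta> t)) \<le> B" "t \<in> {0..T}"
  shows "norm (X t - x) \<le> T * B"
proof -
  have sub: "{0..t} \<subseteq> {0..T}" using assms(3) by auto
  have B: "0 \<le> B" using assms(2)[OF assms(3)] norm_ge_zero order_trans by blast
  have iv: "set_integrable lebesgue {0..t} (\<lambda>s. f (X s) (\<theta> s))"
    using assms(1) by (auto simp: ode_solution_def intro: set_integrable_subset[OF _ _ sub])
  have ic: "set_integrable lebesgue {0..t} (\<lambda>s. B)"
    by (intro absolutely_integrable_continuous_real continuous_intros)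
  have "norm (X t - x) = norm (LINT s:{0..t}|lebesgue. f (X s) (\<theta> s))"
    using assms(1,3) by (auto simp: ode_solution_def)
  also have "\<dots> \<le> (LINT s:{0..t}|lebesgue. norm (f (X s) (\<theta> s)))"
    using integral_norm_bound[of lebesgue "\<lambda>s. indicator {0..t} s *\<^sub>R f (X s) (\<theta> s)"]
    by (simp add: set_lebesgue_integral_def)
  also have "\<dots> \<le> (LINT s:{0..t}|lebesgue. B)"
    using assms(2) sub by (intro set_integral_mono ic set_integrable_norm iv) auto
  also have "\<dots> = t * B" using assms(3) by (simp add: set_lebesgue_integral_def)
  also have "\<dots> \<le> T * B" using assms(3) B by (intro mult_right_mono) auto
  finally show ?thesis .
qed

lemma ode_solution_Lipschitz:
  assumes "ode_solution T f \<theta> a Xa" "ode_solution T f \<theta> b Xb"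
    and K: "0 < K" "\<And>\<xi> \<eta> t. t \<in> {0..T} \<Longrightarrow> norm (f \<xi> (\<theta> t) - f \<eta> (\<theta> t)) \<le> K * norm (\<xi> - \<eta>)"
    and t: "t \<in> {0..T}"
  shows "norm (Xa t - Xb t) \<le> 2 * exp (2 * K * T) * norm (a - b)"
proof -
  have "norm (Xa t - Xb t) \<le> 2 * exp (2 * K * T) * (norm (a - b) + T * 0)"
  proof (rule integral_Gronwall[OF K(1) order_refl _ _ _ _ t])
    show "continuous_on {0..T} (\<lambda>t. Xa t - Xb t)"
      using assms(1,2) by (intro continuous_intros) (auto simp: ode_solution_def)
    show "set_integrable lebesgue {0..T} (\<lambda>t. f (Xa t) (\<theta> t) - f (Xb t) (\<theta> t))"
      using assms(1,2) by (intro set_integral_diff) (auto simp: ode_solution_def)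
    fix t assume t: "t \<in> {0..T}"
    then have "{0..t} \<subseteq> {0..T}" by auto
    then have "set_integrable lebesgue {0..t} (\<lambda>t. f (Xa t) (\<theta> t))" "set_integrable lebesgue {0..t} (\<lambda>t. f (Xb t) (\<theta> t))"
      using assms(1,2) by (auto simp: ode_solution_def intro: set_integrable_subset)
    then show "Xa t - Xb t = a - b + (LINT s:{0..t}|lebesgue. f (Xa s) (\<theta> s) - f (Xb s) (\<theta> s))"
      using assms(1,2) t by (auto simp: ode_solution_def)
    show "norm (f (Xa t) (\<theta> t) - f (Xb t) (\<theta> t)) \<le> K * norm (Xa t - Xb t) + 0"
      using K(2)[OF t] by simp
  qed
  then show ?thesis by simp
qed

text \<open>Linearizing \<open>f\<close> at \<open>Xc\<close> shows that the defect has a rate of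
  change of at most \<open>K\<close> times itself plus remainders, and it starts from exactly 0. In
  \<open>E ^ 3\<close>, two factors come from the squared Lipschitz dependence of \<open>Xa\<close>
  and \<open>Xb\<close> on the initial value, the third from Gronwall's inequality.\<close>

lemma ode_solution_nearly_affine:
  fixes f :: "'a::euclidean_space \<Rightarrow> 'm \<Rightarrow> 'a" and D :: "real \<Rightarrow> 'a \<Rightarrow> 'a \<Rightarrow>\<^sub>L 'a"
  assumes sol: "ode_solution T f \<theta> a Xa" "ode_solution T f \<theta> b Xb"
      "ode_solution T f \<theta> ((1 - s) *\<^sub>R a + s *\<^sub>R b) Xc"
    and s: "s \<in> {0..1}" and K: "0 < K"
    and D: "\<And>\<xi> t. t \<in> {0..T} \<Longrightarrow> ((\<lambda>\<xi>. f \<xi> (\<theta> t)) has_derivative blinfun_apply (D t \<xi>)) (at \<xi>)"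
      "\<And>t. t \<in> {0..T} \<Longrightarrow> L-lipschitz_on UNIV (D t)"
      "\<And>\<xi> t. t \<in> {0..T} \<Longrightarrow> norm (D t \<xi>) \<le> K"
    and t: "t \<in> {0..T}"
  defines "E \<equiv> 2 * exp (2 * K * T)"
  shows "norm ((1 - s) *\<^sub>R Xa t + s *\<^sub>R Xb t - Xc t) \<le> 2 * L * T * E ^ 3 * (norm (a - b))\<^sup>2"
proof -
  define c where "c = (1 - s) *\<^sub>R a + s *\<^sub>R b"
  have L: "0 \<le> L" using D(2)[OF t] by (rule lipschitz_on_nonneg)
  have E: "0 < E" by (simp add: E_def)
  have lip: "norm (f \<xi> (\<theta> t) - f \<eta> (\<theta> t)) \<le> K * norm (\<xi> - \<eta>)" if "t \<in> {0..T}" for \<xi> \<eta> t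
    using that by (intro differentiable_bound[where S = UNIV and f' = "\<lambda>\<xi>. blinfun_apply (D t \<xi>)"])
      (use D in \<open>auto simp: norm_blinfun.rep_eq[symmetric]\<close>)
  have "a - c = s *\<^sub>R (a - b)" "b - c = (1 - s) *\<^sub>R (b - a)" by (auto simp: c_def algebra_simps)
  then have ab: "norm (a - c) \<le> norm (a - b)" "norm (b - c) \<le> norm (a - b)"
    using s by (auto simp: mult_left_le_one_le norm_minus_commute)
  have near: "norm (Xa t - Xc t) \<le> E * norm (a - b)" "norm (Xb t - Xc t) \<le> E * norm (a - b)" if t: "t \<in> {0..T}" for t
    using ode_solution_Lipschitz[OF sol(1,3) K lip t, folded E_def c_def]
      ode_solution_Lipschitz[OF sol(2,3) K lip t, folded E_def c_def]
      mult_left_mono[OF ab(1), of E] mult_left_mono[OF ab(2), of E] E by (auto intro: order_trans)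
  have "norm ((1 - s) *\<^sub>R Xa t + s *\<^sub>R Xb t - Xc t)
      \<le> 2 * exp (2 * K * T) * (norm (0::'a) + T * (2 * L * E\<^sup>2 * (norm (a - b))\<^sup>2))"
  proof (rule integral_Gronwall[OF K _ _ _ _ _ t])
    let ?v = "\<lambda>t. (1 - s) *\<^sub>R f (Xa t) (\<theta> t) + s *\<^sub>R f (Xb t) (\<theta> t) - f (Xc t) (\<theta> t)"
    show "0 \<le> 2 * L * E\<^sup>2 * (norm (a - b))\<^sup>2" using L by simp
    show "continuous_on {0..T} (\<lambda>t. (1 - s) *\<^sub>R Xa t + s *\<^sub>R Xb t - Xc t)"
      using sol by (intro continuous_intros) (auto simp: ode_solution_def)
    show "set_integrable lebesgue {0..T} ?v"
      using sol by (intro set_integral_add set_integral_diff set_integrable_scaleR_right) (auto simp: ode_solution_def)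
    fix t assume t: "t \<in> {0..T}"
    then have "{0..t} \<subseteq> {0..T}" by auto
    then have si: "set_integrable lebesgue {0..t} (\<lambda>t. f (Xa t) (\<theta> t))" "set_integrable lebesgue {0..t} (\<lambda>t. f (Xb t) (\<theta> t))"
        "set_integrable lebesgue {0..t} (\<lambda>t. f (Xc t) (\<theta> t))"
      using sol by (auto simp: ode_solution_def intro: set_integrable_subset)
    have "(LINT s:{0..t}|lebesgue. ?v s) = (1 - s) *\<^sub>R (Xa t - a) + s *\<^sub>R (Xb t - b) - (Xc t - c)"
      using sol t si by (auto simp: ode_solution_def c_def)
    then show "(1 - s) *\<^sub>R Xa t + s *\<^sub>R Xb t - Xc t = 0 + (LINT s:{0..t}|lebesgue. ?v s)"
      by (simp add: c_def algebra_simps)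
    have "norm (?v t) \<le> norm (D t (Xc t)) * norm ((1 - s) *\<^sub>R Xa t + s *\<^sub>R Xb t - Xc t)
        + L * ((norm (Xa t - Xc t))\<^sup>2 + (norm (Xb t - Xc t))\<^sup>2 + (norm (Xc t - Xc t))\<^sup>2)"
      using convex_combination_deviation[where F = "\<lambda>\<xi>. f \<xi> (\<theta> t)", OF D(1)[OF t] D(2)[OF t] s] by blast
    also have "\<dots> \<le> K * norm ((1 - s) *\<^sub>R Xa t + s *\<^sub>R Xb t - Xc t)
        + L * ((E * norm (a - b))\<^sup>2 + (E * norm (a - b))\<^sup>2 + 0\<^sup>2)"
      using L near[OF t] D(3)[OF t] by (intro add_mono mult_left_mono mult_right_mono power_mono) auto
    finally show "norm (?v t) \<le> K * norm ((1 - s) *\<^sub>R Xa t + s *\<^sub>R Xb t - Xc t) + 2 * L * E\<^sup>2 * (norm (a - b))\<^sup>2"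
      by (simp add: power_mult_distrib algebra_simps)
  qed
  then show ?thesis unfolding E_def[symmetric] by (simp add: power3_eq_cube power2_eq_square mult_ac)
qed

lemma flow_uniform_bounds:
  fixes f :: "'a::euclidean_space \<Rightarrow> 'm \<Rightarrow> 'a"
  assumes T: "0 < T" and \<Theta>: "\<And>\<theta> t. \<theta> \<in> \<Theta> \<Longrightarrow> t \<in> {0..T} \<Longrightarrow> \<theta> t \<in> \<Theta>\<^sub>0"
    and B: "\<exists>B. \<forall>\<xi>. \<forall>u\<in>\<Theta>\<^sub>0. norm (f \<xi> u) \<le> B"
    and f: "uniformly_C1_Lipschitz \<Theta>\<^sub>0 f"
    and X: "\<And>\<theta> x. \<theta> \<in> \<Theta> \<Longrightarrow> ode_solution T f \<theta> x (X \<theta> x)"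
  obtains E where "0 \<le> E"
    "\<And>\<theta> x t. \<theta> \<in> \<Theta> \<Longrightarrow> t \<in> {0..T} \<Longrightarrow> norm (X \<theta> x t - x) \<le> E"
    "\<And>\<theta> a b t. \<theta> \<in> \<Theta> \<Longrightarrow> t \<in> {0..T} \<Longrightarrow> norm (X \<theta> a t - X \<theta> b t) \<le> E * norm (a - b)"
    "\<And>\<theta> a b s t. \<theta> \<in> \<Theta> \<Longrightarrow> t \<in> {0..T} \<Longrightarrow> s \<in> {0..1} \<Longrightarrow>
       norm ((1 - s) *\<^sub>R X \<theta> a t + s *\<^sub>R X \<theta> b t - X \<theta> ((1 - s) *\<^sub>R a + s *\<^sub>R b) t) \<le> E * (norm (a - b))\<^sup>2"
\<comment> \<open>Nonnegativity of \<open>B\<close> and \<open>L\<close> is read off from an actual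
  parameter value, so some control has to exist.\<close>
proof (cases "\<Theta> = {}")
  case False
  then obtain \<theta>0 where \<theta>0: "\<theta>0 \<in> \<Theta>" by auto
  obtain B where B: "\<And>\<xi> u. u \<in> \<Theta>\<^sub>0 \<Longrightarrow> norm (f \<xi> u) \<le> B" using assms(3) by auto
  obtain L D where D0: "\<And>u \<xi>. u \<in> \<Theta>\<^sub>0 \<Longrightarrow> ((\<lambda>\<xi>. f \<xi> u) has_derivative blinfun_apply (D u \<xi>)) (at \<xi>)"
      "\<And>u. u \<in> \<Theta>\<^sub>0 \<Longrightarrow> L-lipschitz_on UNIV (D u)"
    using f unfolding uniformly_C1_Lipschitz_def by metis
  have u0: "\<theta>0 0 \<in> \<Theta>\<^sub>0" using \<Theta>[OF \<theta>0, of 0] T by simp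
  have L: "0 \<le> L" using D0(2)[OF u0] by (rule lipschitz_on_nonneg)
  have B0: "0 \<le> B" using B[OF u0] norm_ge_zero order_trans by blast
  \<comment> \<open>\<open>2 * B + L\<close> bounds the derivative of \<open>f\<close>, uniformly
    because \<open>B\<close> and \<open>L\<close> are chosen before the parameter; adding 1 keeps
    \<open>K\<close> positive.\<close>
  define K where "K = 2 * B + L + 1"
  have K: "0 < K" using B0 L by (simp add: K_def)
  have DK: "norm (D u \<xi>) \<le> K" if "u \<in> \<Theta>\<^sub>0" for u \<xi>
    using bounded_Lipschitz_derivative_bound[where F = "\<lambda>\<xi>. f \<xi> u", OF D0(1)[OF that] D0(2)[OF that] B[OF that], of \<xi>]
    by (simp add: K_def)
  define E where "E = 2 * exp (2 * K * T)"
  define E' where "E' = T * B + E + 2 * L * T * E ^ 3"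
  have E: "0 \<le> E" by (simp add: E_def)
  have le: "T * B \<le> E'" "E \<le> E'" "2 * L * T * E ^ 3 \<le> E'" using T B0 L E by (auto simp: E'_def)
  show thesis
  proof (rule that[of E'])
    show "0 \<le> E'" using E le by simp
    fix \<theta> t assume \<theta>: "\<theta> \<in> \<Theta>" and t: "t \<in> {0..T}"
    note mem = \<Theta>[OF \<theta>]
    show "norm (X \<theta> x t - x) \<le> E'" for x
      using ode_solution_displacement[OF X[OF \<theta>] B[OF mem] t] le order_trans by blast
    have lip: "norm (f \<xi> (\<theta> t) - f \<eta> (\<theta> t)) \<le> K * norm (\<xi> - \<eta>)" if "t \<in> {0..T}" for \<xi> \<eta> t
      by (intro differentiable_bound[where S = UNIV and f' = "\<lambda>\<xi>. blinfun_apply (D (\<theta> t) \<xi>)"])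
        (use D0 DK mem[OF that] in \<open>auto simp: norm_blinfun.rep_eq[symmetric]\<close>)
    show "norm (X \<theta> a t - X \<theta> b t) \<le> E' * norm (a - b)" for a b
      using ode_solution_Lipschitz[OF X[OF \<theta>] X[OF \<theta>] K lip t, of a b, folded E_def]
        mult_right_mono[OF le(2), of "norm (a - b)"] by auto
    fix s :: real and a b assume s: "s \<in> {0..1}"
    have "norm ((1 - s) *\<^sub>R X \<theta> a t + s *\<^sub>R X \<theta> b t - X \<theta> ((1 - s) *\<^sub>R a + s *\<^sub>R b) t)
        \<le> 2 * L * T * E ^ 3 * (norm (a - b))\<^sup>2"
      unfolding E_def
      by (rule ode_solution_nearly_affine[OF X[OF \<theta>] X[OF \<theta>] X[OF \<theta>] s K, where D = "\<lambda>t. D (\<theta> t)"])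
        (use D0 DK mem t in auto)
    also have "\<dots> \<le> E' * (norm (a - b))\<^sup>2" using le by (intro mult_right_mono) auto
    finally show "norm ((1 - s) *\<^sub>R X \<theta> a t + s *\<^sub>R X \<theta> b t - X \<theta> ((1 - s) *\<^sub>R a + s *\<^sub>R b) t) \<le> E' * (norm (a - b))\<^sup>2" .
  qed
qed (use that[of 0] in auto)

section \<open>Regularity of the cost\<close>

lemma gradient_eqI:
  assumes "GDERIV g x :> A" shows "gradient g x = A"
  unfolding gradient_def
proof (rule the_equality[of "\<lambda>D. GDERIV g x :> D", OF assms])
  fix D assume "GDERIV g x :> D"
  then have "(\<lambda>h. h \<bullet> D) = (\<lambda>h. h \<bullet> A)"
    using assms has_derivative_unique unfolding gderiv_def by blast
  then have "(D - A) \<bullet> D = (D - A) \<bullet> A" by (rule fun_cong)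
  then have "(D - A) \<bullet> (D - A) = 0" by (simp add: inner_diff_right)
  then show "D = A" by simp
qed

text \<open>The Riesz representation in coordinates. It turns bounds on gradients at 0 into operator
  norm bounds on the derivatives supplied by \<open>uniformly_C1_Lipschitz\<close>.\<close>

lemma norm_derivative_le_gradient:
  fixes g :: "'a::euclidean_space \<Rightarrow> real"
  assumes "(g has_derivative blinfun_apply D) (at x)"
  shows "norm D \<le> norm (gradient g x)"
proof -
  define A where "A = (\<Sum>b\<in>Basis. D b *\<^sub>R b)"
  have A: "blinfun_apply D = (\<lambda>h. h \<bullet> A)"
  proof
    fix h
    have "D h = D (\<Sum>b\<in>Basis. (h \<bullet> b) *\<^sub>R b)" by (simp add: euclidean_representation)
    also have "\<dots> = (\<Sum>b\<in>Basis. (h \<bullet> b) * D b)" by (simp add: blinfun.bilinear_simps)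
    finally show "D h = h \<bullet> A" by (simp add: A_def inner_sum_right mult_ac)
  qed
  have "gradient g x = A" by (rule gradient_eqI) (use assms A in \<open>simp add: gderiv_def\<close>)
  then show ?thesis
    by (intro norm_blinfun_bound) (auto simp: A Cauchy_Schwarz_ineq2 mult.commute)
qed

lemma Caratheodory_measurable:
  fixes \<phi> :: "'a::{second_countable_topology, metric_space} \<Rightarrow> 'm::topological_space \<Rightarrow> real"
  assumes \<theta>: "\<theta> \<in> borel_measurable M" "\<And>t. t \<in> space M \<Longrightarrow> \<theta> t \<in> S"
    and X: "X \<in> borel_measurable M"
    and c1: "\<And>\<xi>. continuous_on S (\<phi> \<xi>)" and c2: "\<And>u. u \<in> S \<Longrightarrow> continuous_on UNIV (\<lambda>\<xi>. \<phi> \<xi> u)"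
  shows "(\<lambda>t. \<phi> (X t) (\<theta> t)) \<in> borel_measurable M"
proof -
  obtain F where F: "\<And>i. simple_function M (F i)" "\<And>t. t \<in> space M \<Longrightarrow> (\<lambda>i. F i t) \<longlonglongrightarrow> X t"
    using borel_measurable_implies_sequence_metric[OF X] by blast
  have \<theta>S: "\<theta> \<in> M \<rightarrow>\<^sub>M restrict_space borel S"
    using \<theta> by (intro measurable_restrict_space2) auto
  have "(\<lambda>t. \<phi> (F i t) (\<theta> t)) \<in> borel_measurable M" for i
  proof (rule measurable_compose_countable'[where I = "F i ` space M"])
    show "(\<lambda>t. \<phi> y (\<theta> t)) \<in> borel_measurable M" for y
      by (rule measurable_compose[OF \<theta>S borel_measurable_continuous_on_restrict[OF c1]])
    show "F i \<in> M \<rightarrow>\<^sub>M count_space (F i ` space M)"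
      using F(1)[of i] by (subst measurable_count_space_eq_countable) (auto simp: simple_function_def countable_finite)
    show "countable (F i ` space M)"
      using F(1)[of i] by (simp add: simple_function_def countable_finite)
  qed
  then show ?thesis
  proof (rule borel_measurable_LIMSEQ_real[rotated])
    fix t assume t: "t \<in> space M"
    show "(\<lambda>i. \<phi> (F i t) (\<theta> t)) \<longlonglongrightarrow> \<phi> (X t) (\<theta> t)"
      using continuous_on_tendsto_compose[OF c2[OF \<theta>(2)[OF t]] F(2)[OF t]] by auto
  qed
qed

text \<open>The index \<open>i\<close> stands for a pair of a control and a time, so a single
  constant covers the running cost at all times and the terminal cost. Linearizing at
  \<open>Y i x\<close> requires a derivative bound only there, and \<open>x\<close> is confined to a
  ball; the remainders are quadratic for arbitrary \<open>a\<close> and \<open>b\<close>.\<close>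

lemma composition_with_flow_bounds:
  fixes h :: "'a::euclidean_space \<Rightarrow> 'm \<Rightarrow> real" and Y :: "'c \<Rightarrow> 'a \<Rightarrow> 'a" and w :: "'c \<Rightarrow> 'm"
  assumes h: "uniformly_C1_Lipschitz \<Theta>\<^sub>0 h"
    and G: "bounded ((\<lambda>u. gradient (\<lambda>\<xi>. h \<xi> u) 0) ` \<Theta>\<^sub>0)"
    and w: "\<And>i. i \<in> I \<Longrightarrow> w i \<in> \<Theta>\<^sub>0"
    and E: "0 \<le> E" "\<And>i x. i \<in> I \<Longrightarrow> norm (Y i x - x) \<le> E"
      "\<And>i a b. i \<in> I \<Longrightarrow> norm (Y i a - Y i b) \<le> E * norm (a - b)"
      "\<And>i a b s. i \<in> I \<Longrightarrow> s \<in> {0..1} \<Longrightarrow>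
         norm ((1 - s) *\<^sub>R Y i a + s *\<^sub>R Y i b - Y i ((1 - s) *\<^sub>R a + s *\<^sub>R b)) \<le> E * (norm (a - b))\<^sup>2"
  obtains M where "0 \<le> M"
    "\<And>i x a b s. i \<in> I \<Longrightarrow> norm x \<le> R \<Longrightarrow> s \<in> {0..1} \<Longrightarrow>
       \<bar>(1 - s) * h (Y i a) (w i) + s * h (Y i b) (w i) - h (Y i ((1 - s) *\<^sub>R a + s *\<^sub>R b)) (w i)\<bar>
         \<le> M * ((norm (a - x))\<^sup>2 + (norm (b - x))\<^sup>2)"
    "\<And>i x a. i \<in> I \<Longrightarrow> norm x \<le> R \<Longrightarrow>
       \<bar>h (Y i a) (w i) - h (Y i x) (w i)\<bar> \<le> M * (norm (a - x) + (norm (a - x))\<^sup>2)"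
\<comment> \<open>In the degenerate case the premises of all bounds are unsatisfiable and the
  constant 0 serves; otherwise an index and \<open>0 \<le> R\<close> yield the signs of the
  constants.\<close>
proof (cases "I = {} \<or> R < 0")
  case False
  then obtain i0 where "i0 \<in> I" by auto
  then have u0: "w i0 \<in> \<Theta>\<^sub>0" by (rule w)
  have R: "0 \<le> R" using False by simp
  obtain L D where D: "\<And>u \<xi>. u \<in> \<Theta>\<^sub>0 \<Longrightarrow> ((\<lambda>\<xi>. h \<xi> u) has_derivative blinfun_apply (D u \<xi>)) (at \<xi>)"
      "\<And>u. u \<in> \<Theta>\<^sub>0 \<Longrightarrow> L-lipschitz_on UNIV (D u)"
    using h unfolding uniformly_C1_Lipschitz_def by metis
  obtain G0 where G0: "\<And>u. u \<in> \<Theta>\<^sub>0 \<Longrightarrow> norm (gradient (\<lambda>\<xi>. h \<xi> u) 0) \<le> G0"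
    using G unfolding bounded_iff by auto
  have L: "0 \<le> L" using D(2)[OF u0] by (rule lipschitz_on_nonneg)
  have G0': "0 \<le> G0" using G0[OF u0] norm_ge_zero order_trans by blast
  \<comment> \<open>The derivative of \<open>h\<close> is at most \<open>G0\<close> at the origin
    and grows at rate \<open>L\<close>; for \<open>norm x \<le> R\<close> the point
    \<open>Y i x\<close> has norm at most \<open>R + E\<close>.\<close>
  define M0 where "M0 = G0 + L * (R + E)"
  have M0: "0 \<le> M0" using G0' L R E by (simp add: M0_def)
  have DM: "norm (D (w i) (Y i x)) \<le> M0" if i: "i \<in> I" and x: "norm x \<le> R" for i x
  proof -
    have "norm (D (w i) 0) \<le> G0"
      using norm_derivative_le_gradient[OF D(1)[OF w[OF i]]] G0[OF w[OF i]] order_trans by blast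
    moreover have "norm (D (w i) (Y i x) - D (w i) 0) \<le> L * norm (Y i x)"
      using lipschitz_onD[OF D(2)[OF w[OF i]], of "Y i x" 0] by (simp add: dist_norm)
    moreover have "norm (Y i x) \<le> R + E" using E(2)[OF i, of x] x norm_triangle_sub[of "Y i x" x] by simp
    then have "L * norm (Y i x) \<le> L * (R + E)" using L by (rule mult_left_mono)
    ultimately show ?thesis using norm_triangle_sub[of "D (w i) (Y i x)" "D (w i) 0"] by (simp add: M0_def)
  qed
  \<comment> \<open>The first term is the defect of the flow, where \<open>norm (a - b)\<close>
    squared costs a factor 2 when measured from \<open>x\<close>. The second collects the three
    remainders, at \<open>a\<close>, at \<open>b\<close> and at their convex combination.\<close>
  define M where "M = 2 * M0 * E + 2 * L * E\<^sup>2"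
  show thesis
  proof (rule that[of M])
    show "0 \<le> M" using M0 E L by (simp add: M_def)
    fix i and x a :: 'a assume i: "i \<in> I" and x: "norm x \<le> R"
    note near = E(3)[OF i, of _ x]
    have near2: "(norm (Y i y - Y i x))\<^sup>2 \<le> E\<^sup>2 * (norm (y - x))\<^sup>2" for y
      using power_mono[OF near, of y 2] by (simp add: power_mult_distrib)
    {
      have "\<bar>h (Y i a) (w i) - h (Y i x) (w i) - D (w i) (Y i x) (Y i a - Y i x)\<bar> \<le> L * (norm (Y i a - Y i x))\<^sup>2"
        using derivative_Lipschitz_remainder[where F = "\<lambda>\<xi>. h \<xi> (w i)", OF D(1)[OF w[OF i]] D(2)[OF w[OF i]]] by simp
      moreover have "\<bar>D (w i) (Y i x) (Y i a - Y i x)\<bar> \<le> norm (D (w i) (Y i x)) * norm (Y i a - Y i x)"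
        using norm_blinfun[of "D (w i) (Y i x)" "Y i a - Y i x"] by simp
      moreover have "norm (D (w i) (Y i x)) * norm (Y i a - Y i x) \<le> M0 * (E * norm (a - x))"
        using M0 by (intro mult_mono DM i x near) auto
      moreover have "L * (norm (Y i a - Y i x))\<^sup>2 \<le> L * (E\<^sup>2 * (norm (a - x))\<^sup>2)"
        by (intro mult_left_mono near2 L)
      ultimately have "\<bar>h (Y i a) (w i) - h (Y i x) (w i)\<bar> \<le> M0 * (E * norm (a - x)) + L * (E\<^sup>2 * (norm (a - x))\<^sup>2)"
        by linarith
      also have "\<dots> \<le> M * norm (a - x) + M * (norm (a - x))\<^sup>2"
      proof (rule add_mono)
        have "0 \<le> M0 * (E * norm (a - x)) + 2 * L * E\<^sup>2 * norm (a - x)" using M0 E L by simp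
        then show "M0 * (E * norm (a - x)) \<le> M * norm (a - x)" by (simp add: M_def algebra_simps)
        have "0 \<le> L * (E\<^sup>2 * (norm (a - x))\<^sup>2) + 2 * M0 * E * (norm (a - x))\<^sup>2" using M0 E L by simp
        then show "L * (E\<^sup>2 * (norm (a - x))\<^sup>2) \<le> M * (norm (a - x))\<^sup>2" by (simp add: M_def algebra_simps)
      qed
      finally show "\<bar>h (Y i a) (w i) - h (Y i x) (w i)\<bar> \<le> M * (norm (a - x) + (norm (a - x))\<^sup>2)"
        by (simp add: algebra_simps)
    }
    fix b and s :: real assume s: "s \<in> {0..1}"
    let ?c = "(1 - s) *\<^sub>R a + s *\<^sub>R b" and ?Q = "(norm (a - x))\<^sup>2 + (norm (b - x))\<^sup>2"
    have "norm (?c - x) = norm ((1 - s) *\<^sub>R (a - x) + s *\<^sub>R (b - x))"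
      by (simp add: algebra_simps)
    also have "\<dots> \<le> (1 - s) * norm (a - x) + s * norm (b - x)"
      using s norm_triangle_ineq[of "(1 - s) *\<^sub>R (a - x)" "s *\<^sub>R (b - x)"] by simp
    also have "\<dots> \<le> max (norm (a - x)) (norm (b - x))"
      using s by (intro convex_bound_le) auto
    finally have c: "(norm (?c - x))\<^sup>2 \<le> ?Q"
      using power_mono[of "norm (?c - x)" "norm (a - x)" 2] power_mono[of "norm (?c - x)" "norm (b - x)" 2]
      by (auto simp: max_def add_increasing add_increasing2 split: if_splits)
    have "norm (a - b) \<le> norm (a - x) + norm (b - x)"
      using norm_triangle_ineq4[of "a - x" "b - x"] by simp
    then have "(norm (a - b))\<^sup>2 \<le> (norm (a - x) + norm (b - x))\<^sup>2" by (rule power_mono) simp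
    also have "\<dots> \<le> 2 * ?Q"
      using sum_squares_bound[of "norm (a - x)" "norm (b - x)"] by (simp add: power2_sum)
    finally have ab: "(norm (a - b))\<^sup>2 \<le> 2 * ?Q" .
    have "norm ((1 - s) *\<^sub>R h (Y i a) (w i) + s *\<^sub>R h (Y i b) (w i) - h (Y i ?c) (w i))
      \<le> norm (D (w i) (Y i x)) * norm ((1 - s) *\<^sub>R Y i a + s *\<^sub>R Y i b - Y i ?c)
        + L * ((norm (Y i a - Y i x))\<^sup>2 + (norm (Y i b - Y i x))\<^sup>2 + (norm (Y i ?c - Y i x))\<^sup>2)"
      by (rule convex_combination_deviation[where F = "\<lambda>\<xi>. h \<xi> (w i)", OF D(1)[OF w[OF i]] D(2)[OF w[OF i]] s])
    also have "\<dots> \<le> M0 * (E * (2 * ?Q)) + L * (E\<^sup>2 * (norm (a - x))\<^sup>2 + E\<^sup>2 * (norm (b - x))\<^sup>2 + E\<^sup>2 * ?Q)"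
    proof (intro add_mono mult_left_mono mult_mono near2 L DM i x M0 norm_ge_zero)
      show "norm ((1 - s) *\<^sub>R Y i a + s *\<^sub>R Y i b - Y i ?c) \<le> E * (2 * ?Q)"
        using E(4)[OF i s, of a b] mult_left_mono[OF ab E(1)] by linarith
      show "(norm (Y i ?c - Y i x))\<^sup>2 \<le> E\<^sup>2 * ?Q"
        using near2[of ?c] mult_left_mono[OF c, of "E\<^sup>2"] by simp
    qed
    also have "\<dots> = M * ?Q" by (simp add: M_def algebra_simps)
    finally show "\<bar>(1 - s) * h (Y i a) (w i) + s * h (Y i b) (w i) - h (Y i ?c) (w i)\<bar> \<le> M * ?Q"
      by simp
  qed
next
  case True
  then have False if "i \<in> I" "norm x \<le> R" for i :: 'c and x :: 'a
    using that norm_ge_zero[of x] by auto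
  then show thesis by (intro that[of 0]) auto
qed

lemma cost_regularity:
  fixes f :: "'a::euclidean_space \<Rightarrow> 'm::real_normed_vector \<Rightarrow> 'a"
  assumes T: "0 < T"
    and \<theta>: "\<And>\<theta>. \<theta> \<in> \<Theta> \<Longrightarrow> \<theta> \<in> borel_measurable (lebesgue_on {0..T})"
      "\<And>\<theta> t. \<theta> \<in> \<Theta> \<Longrightarrow> t \<in> {0..T} \<Longrightarrow> \<theta> t \<in> \<Theta>\<^sub>0"
    and B: "\<exists>B. \<forall>\<xi>. \<forall>u\<in>\<Theta>\<^sub>0. norm (f \<xi> u) \<le> B"
    and cont: "\<And>\<xi>. continuous_on \<Theta>\<^sub>0 (\<Phi> \<xi>)"
    and C1: "uniformly_C1_Lipschitz \<Theta>\<^sub>0 f" "uniformly_C1_Lipschitz \<Theta>\<^sub>0 \<Phi>" "uniformly_C1_Lipschitz \<Theta>\<^sub>0 \<l>"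
    and G: "bounded ((\<lambda>u. gradient (\<lambda>\<xi>. \<Phi> \<xi> u) 0) ` \<Theta>\<^sub>0)" "bounded ((\<lambda>u. gradient (\<lambda>\<xi>. \<l> \<xi> u) 0) ` \<Theta>\<^sub>0)"
    and X: "\<And>\<theta> x. \<theta> \<in> \<Theta> \<Longrightarrow> ode_solution T f \<theta> x (X \<theta> x)"
  obtains C where "0 \<le> C"
    "\<And>\<theta> x a b s. \<theta> \<in> \<Theta> \<Longrightarrow> norm x \<le> R \<Longrightarrow> s \<in> {0..1} \<Longrightarrow>
       \<bar>(1 - s) * cost T \<Phi> \<l> X a \<theta> + s * cost T \<Phi> \<l> X b \<theta> - cost T \<Phi> \<l> X ((1 - s) *\<^sub>R a + s *\<^sub>R b) \<theta>\<bar>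
         \<le> C * ((norm (a - x))\<^sup>2 + (norm (b - x))\<^sup>2)"
    "\<And>\<theta> x a. \<theta> \<in> \<Theta> \<Longrightarrow> norm x \<le> R \<Longrightarrow>
       \<bar>cost T \<Phi> \<l> X a \<theta> - cost T \<Phi> \<l> X x \<theta>\<bar> \<le> C * (norm (a - x) + (norm (a - x))\<^sup>2)"
proof (rule flow_uniform_bounds[of T \<Theta> \<Theta>\<^sub>0 f X])
  show "\<theta> t \<in> \<Theta>\<^sub>0" if "\<theta> \<in> \<Theta>" "t \<in> {0..T}" for \<theta> t
    by (rule \<theta>(2)[OF that])
  show "ode_solution T f \<theta> x (X \<theta> x)" if "\<theta> \<in> \<Theta>" for \<theta> x
    by (rule X[OF that])
  fix E assume E: "0 \<le> E"
    "\<And>\<theta> x t. \<theta> \<in> \<Theta> \<Longrightarrow> t \<in> {0..T} \<Longrightarrow> norm (X \<theta> x t - x) \<le> E"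
    "\<And>\<theta> a b t. \<theta> \<in> \<Theta> \<Longrightarrow> t \<in> {0..T} \<Longrightarrow> norm (X \<theta> a t - X \<theta> b t) \<le> E * norm (a - b)"
    "\<And>\<theta> a b s t. \<theta> \<in> \<Theta> \<Longrightarrow> t \<in> {0..T} \<Longrightarrow> s \<in> {0..1} \<Longrightarrow>
       norm ((1 - s) *\<^sub>R X \<theta> a t + s *\<^sub>R X \<theta> b t - X \<theta> ((1 - s) *\<^sub>R a + s *\<^sub>R b) t) \<le> E * (norm (a - b))\<^sup>2"
  define I where "I = \<Theta> \<times> {0..T}"
  define w where "w = (\<lambda>(\<theta> :: real \<Rightarrow> 'm, t :: real). \<theta> t)"
  define Y where "Y = (\<lambda>(\<theta>, t) x. X \<theta> x t)"
  have w: "i \<in> I \<Longrightarrow> w i \<in> \<Theta>\<^sub>0" for i using \<theta>(2) by (auto simp: I_def w_def)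
  have E': "i \<in> I \<Longrightarrow> norm (Y i x - x) \<le> E" "i \<in> I \<Longrightarrow> norm (Y i a - Y i b) \<le> E * norm (a - b)"
    "i \<in> I \<Longrightarrow> s \<in> {0..1} \<Longrightarrow>
       norm ((1 - s) *\<^sub>R Y i a + s *\<^sub>R Y i b - Y i ((1 - s) *\<^sub>R a + s *\<^sub>R b)) \<le> E * (norm (a - b))\<^sup>2" for i x a b s
    using E by (auto simp: I_def Y_def)
  \<comment> \<open>The radius is generalized here: besides the given \<open>R\<close>, the
    comparison of integrability below uses the radius \<open>norm b\<close> of an arbitrary initial
    point.\<close>
  have bnd: "\<exists>M\<ge>0. (\<forall>\<theta>\<in>\<Theta>. \<forall>t\<in>{0..T}. \<forall>x. norm x \<le> R \<longrightarrow>
      (\<forall>a b. \<forall>s\<in>{0..1}. \<bar>(1 - s) * h (X \<theta> a t) (\<theta> t) + s * h (X \<theta> b t) (\<theta> t) - h (X \<theta> ((1 - s) *\<^sub>R a + s *\<^sub>R b) t) (\<theta> t)\<bar>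
         \<le> M * ((norm (a - x))\<^sup>2 + (norm (b - x))\<^sup>2)) \<and>
      (\<forall>a. \<bar>h (X \<theta> a t) (\<theta> t) - h (X \<theta> x t) (\<theta> t)\<bar> \<le> M * (norm (a - x) + (norm (a - x))\<^sup>2)))"
    if "uniformly_C1_Lipschitz \<Theta>\<^sub>0 h" "bounded ((\<lambda>u. gradient (\<lambda>\<xi>. h \<xi> u) 0) ` \<Theta>\<^sub>0)" for h :: "'a \<Rightarrow> 'm \<Rightarrow> real" and R
  proof (rule composition_with_flow_bounds[where I = I and w = w and Y = Y and R = R and \<Theta>\<^sub>0 = \<Theta>\<^sub>0 and h = h and E = E])
    fix M assume M: "0 \<le> M" "\<And>i x a b s. i \<in> I \<Longrightarrow> norm x \<le> R \<Longrightarrow> s \<in> {0..1} \<Longrightarrow>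
       \<bar>(1 - s) * h (Y i a) (w i) + s * h (Y i b) (w i) - h (Y i ((1 - s) *\<^sub>R a + s *\<^sub>R b)) (w i)\<bar>
         \<le> M * ((norm (a - x))\<^sup>2 + (norm (b - x))\<^sup>2)"
      "\<And>i x a. i \<in> I \<Longrightarrow> norm x \<le> R \<Longrightarrow>
       \<bar>h (Y i a) (w i) - h (Y i x) (w i)\<bar> \<le> M * (norm (a - x) + (norm (a - x))\<^sup>2)"
    have "(\<theta>, t) \<in> I" if "\<theta> \<in> \<Theta>" "t \<in> {0..T}" for \<theta> t using that by (simp add: I_def)
    from M(2)[OF this] M(3)[OF this] M(1) show ?thesis
      by (intro exI[of _ M]) (simp add: Y_def w_def)
  qed (fact that w E(1) E')+
  obtain Ml where Ml: "0 \<le> Ml" "\<And>\<theta> t x a b s. \<theta> \<in> \<Theta> \<Longrightarrow> t \<in> {0..T} \<Longrightarrow> norm x \<le> R \<Longrightarrow> s \<in> {0..1} \<Longrightarrow>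
      \<bar>(1 - s) * \<l> (X \<theta> a t) (\<theta> t) + s * \<l> (X \<theta> b t) (\<theta> t) - \<l> (X \<theta> ((1 - s) *\<^sub>R a + s *\<^sub>R b) t) (\<theta> t)\<bar>
         \<le> Ml * ((norm (a - x))\<^sup>2 + (norm (b - x))\<^sup>2)"
     "\<And>\<theta> t x a. \<theta> \<in> \<Theta> \<Longrightarrow> t \<in> {0..T} \<Longrightarrow> norm x \<le> R \<Longrightarrow>
      \<bar>\<l> (X \<theta> a t) (\<theta> t) - \<l> (X \<theta> x t) (\<theta> t)\<bar> \<le> Ml * (norm (a - x) + (norm (a - x))\<^sup>2)"
    using bnd[OF C1(3) G(2), of R] by meson
  obtain Mp where Mp: "0 \<le> Mp" "\<And>\<theta> t x a b s. \<theta> \<in> \<Theta> \<Longrightarrow> t \<in> {0..T} \<Longrightarrow> norm x \<le> R \<Longrightarrow> s \<in> {0..1} \<Longrightarrow>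
      \<bar>(1 - s) * \<Phi> (X \<theta> a t) (\<theta> t) + s * \<Phi> (X \<theta> b t) (\<theta> t) - \<Phi> (X \<theta> ((1 - s) *\<^sub>R a + s *\<^sub>R b) t) (\<theta> t)\<bar>
         \<le> Mp * ((norm (a - x))\<^sup>2 + (norm (b - x))\<^sup>2)"
     "\<And>\<theta> t x a. \<theta> \<in> \<Theta> \<Longrightarrow> t \<in> {0..T} \<Longrightarrow> norm x \<le> R \<Longrightarrow>
      \<bar>\<Phi> (X \<theta> a t) (\<theta> t) - \<Phi> (X \<theta> x t) (\<theta> t)\<bar> \<le> Mp * (norm (a - x) + (norm (a - x))\<^sup>2)"
    using bnd[OF C1(2) G(1), of R] by meson
  define P where "P \<theta> x = (\<lambda>t. \<Phi> (X \<theta> x t) (\<theta> t))" for \<theta> x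
  have setint: "set_integrable lebesgue {0..T} g \<longleftrightarrow> integrable (lebesgue_on {0..T}) g" for g :: "real \<Rightarrow> real"
    by (simp add: set_integrable_def integrable_restrict_space)
  have meas: "P \<theta> x \<in> borel_measurable (lebesgue_on {0..T})" if "\<theta> \<in> \<Theta>" for \<theta> x
    unfolding P_def
  proof (rule Caratheodory_measurable[OF \<theta>(1)[OF that] _ _ cont])
    show "X \<theta> x \<in> borel_measurable (lebesgue_on {0..T})"
      using X[OF that, of x] by (intro continuous_imp_measurable_on_sets_lebesgue) (auto simp: ode_solution_def)
    show "continuous_on UNIV (\<lambda>\<xi>. \<Phi> \<xi> u)" if "u \<in> \<Theta>\<^sub>0" for u
      using C1(2) that unfolding uniformly_C1_Lipschitz_def
      by (meson continuous_at_imp_continuous_on has_derivative_continuous)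
  qed (use \<theta>(2)[OF that] in auto)
  \<comment> \<open>The running costs from two initial points differ by a bounded measurable
    function on a bounded time interval, so they are integrable or not integrable together.\<close>
  have transfer: "set_integrable lebesgue {0..T} (P \<theta> a)" if \<theta>: "\<theta> \<in> \<Theta>" and b: "set_integrable lebesgue {0..T} (P \<theta> b)" for \<theta> a b
  proof -
    obtain M where M: "\<And>t. t \<in> {0..T} \<Longrightarrow> \<bar>P \<theta> a t - P \<theta> b t\<bar> \<le> M"
      using bnd[OF C1(2) G(1), of "norm b"] \<theta> unfolding P_def by blast
    have "integrable (lebesgue_on {0..T}) (\<lambda>t. P \<theta> a t - P \<theta> b t)"
      
      by (rule integrableI_bounded_set[where A = "{0..T}" and B = M])
        (use meas[OF \<theta>] M T in \<open>auto simp: emeasure_restrict_space sets_restrict_space_iff\<close>)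
    then have "integrable (lebesgue_on {0..T}) (\<lambda>t. (P \<theta> a t - P \<theta> b t) + P \<theta> b t)"
      using b unfolding setint by (intro Bochner_Integration.integrable_add)
    then show ?thesis by (simp add: setint)
  qed
  have bint: "\<bar>LINT t:{0..T}|lebesgue. g t\<bar> \<le> T * M"
    if "set_integrable lebesgue {0..T} g" "\<And>t. t \<in> {0..T} \<Longrightarrow> \<bar>g t\<bar> \<le> M" for g :: "real \<Rightarrow> real" and M
  proof -
    have "\<bar>LINT t:{0..T}|lebesgue. g t\<bar> \<le> (LINT t:{0..T}|lebesgue. \<bar>g t\<bar>)"
      using integral_norm_bound[of lebesgue "\<lambda>s. indicator {0..T} s *\<^sub>R g s"]
      by (simp add: set_lebesgue_integral_def abs_mult)
    also have "\<dots> \<le> (LINT t:{0..T}|lebesgue. M)"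
      using that absolutely_integrable_continuous_real[OF continuous_on_const]
      by (intro set_integral_mono set_integrable_abs)
    also have "\<dots> = T * M" using T by (simp add: set_lebesgue_integral_def)
    finally show ?thesis .
  qed
  define J where "J \<theta> x = (LINT t:{0..T}|lebesgue. P \<theta> x t)" for \<theta> x
  have cost: "cost T \<Phi> \<l> X x \<theta> = \<l> (X \<theta> x T) (\<theta> T) + J \<theta> x" for x \<theta>
    by (simp add: cost_def J_def P_def)
  have TT: "T \<in> {0..T}" using T by simp
  show thesis
  proof (rule that[of "Ml + T * Mp"])
    show "0 \<le> Ml + T * Mp" using Ml Mp T by simp
    fix \<theta> and x a :: 'a assume \<theta>: "\<theta> \<in> \<Theta>" and x: "norm x \<le> R"
    \<comment> \<open>Only the gradient of the running cost is bounded in the parameter, so the running cost may fail to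
      be integrable in time. It then fails for every initial point, and all integrals are \<open>0\<close>.\<close>
    have J1: "\<bar>J \<theta> a - J \<theta> x\<bar> \<le> T * (Mp * (norm (a - x) + (norm (a - x))\<^sup>2))"
    proof (cases "set_integrable lebesgue {0..T} (P \<theta> x)")
      case True
      note i = transfer[OF \<theta> True]
      have "J \<theta> a - J \<theta> x = (LINT t:{0..T}|lebesgue. P \<theta> a t - P \<theta> x t)"
        using i by (simp add: J_def)
      moreover have "set_integrable lebesgue {0..T} (\<lambda>t. P \<theta> a t - P \<theta> x t)"
        using i by (intro set_integral_diff)
      moreover have "\<bar>P \<theta> a t - P \<theta> x t\<bar> \<le> Mp * (norm (a - x) + (norm (a - x))\<^sup>2)" if "t \<in> {0..T}" for t
        using Mp(3)[OF \<theta> that x] by (simp only: P_def)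
      ultimately show ?thesis by (simp only: bint)
    next
      case False
      then have "\<not> set_integrable lebesgue {0..T} (P \<theta> a)" using transfer[OF \<theta>] by blast
      with False have "J \<theta> a = 0" "J \<theta> x = 0"
        by (auto simp: J_def set_lebesgue_integral_def set_integrable_def not_integrable_integral_eq)
      then show ?thesis using T Mp(1) by simp
    qed
    then show "\<bar>cost T \<Phi> \<l> X a \<theta> - cost T \<Phi> \<l> X x \<theta>\<bar> \<le> (Ml + T * Mp) * (norm (a - x) + (norm (a - x))\<^sup>2)"
      using Ml(3)[OF \<theta> TT x, of a] unfolding cost distrib_right mult.assoc by linarith
    fix b and s :: real assume s: "s \<in> {0..1}"
    let ?c = "(1 - s) *\<^sub>R a + s *\<^sub>R b" and ?Q = "(norm (a - x))\<^sup>2 + (norm (b - x))\<^sup>2"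
    have J2: "\<bar>(1 - s) * J \<theta> a + s * J \<theta> b - J \<theta> ?c\<bar> \<le> T * (Mp * ?Q)"
    proof (cases "set_integrable lebesgue {0..T} (P \<theta> x)")
      case True
      note i = transfer[OF \<theta> True]
      have "(1 - s) * J \<theta> a + s * J \<theta> b - J \<theta> ?c = (LINT t:{0..T}|lebesgue. (1 - s) * P \<theta> a t + s * P \<theta> b t - P \<theta> ?c t)"
        using i by (simp add: J_def)
      moreover have "set_integrable lebesgue {0..T} (\<lambda>t. (1 - s) * P \<theta> a t + s * P \<theta> b t - P \<theta> ?c t)"
        using i by simp
      moreover have "\<bar>(1 - s) * P \<theta> a t + s * P \<theta> b t - P \<theta> ?c t\<bar> \<le> Mp * ?Q" if "t \<in> {0..T}" for t
        using Mp(2)[OF \<theta> that x s] by (simp only: P_def)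
      ultimately show ?thesis by (simp only: bint)
    next
      case False
      then have "\<not> set_integrable lebesgue {0..T} (P \<theta> a)" for a using transfer[OF \<theta>] by blast
      then have "J \<theta> a = 0" for a
        by (auto simp: J_def set_lebesgue_integral_def set_integrable_def not_integrable_integral_eq)
      then show ?thesis using T Mp(1) by simp
    qed
    have "(1 - s) * cost T \<Phi> \<l> X a \<theta> + s * cost T \<Phi> \<l> X b \<theta> - cost T \<Phi> \<l> X ?c \<theta>
       = ((1 - s) * \<l> (X \<theta> a T) (\<theta> T) + s * \<l> (X \<theta> b T) (\<theta> T) - \<l> (X \<theta> ?c T) (\<theta> T))
         + ((1 - s) * J \<theta> a + s * J \<theta> b - J \<theta> ?c)"
      by (simp add: cost algebra_simps)
    then show "\<bar>(1 - s) * cost T \<Phi> \<l> X a \<theta> + s * cost T \<Phi> \<l> X b \<theta> - cost T \<Phi> \<l> X ?c \<theta>\<bar> \<le> (Ml + T * Mp) * ?Q"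
      using Ml(2)[OF \<theta> TT x s, of a b] J2 unfolding distrib_right[of Ml "T * Mp"] mult.assoc by linarith
  qed
qed (rule T B C1(1))+

section \<open>Norms and conjugate exponents\<close>

lemma is_norm_zero: "is_norm N \<Longrightarrow> N 0 = 0"
  unfolding is_norm_def by blast

lemma is_norm_sum_le:
  assumes "is_norm N" "finite A" shows "N (\<Sum>i\<in>A. g i) \<le> (\<Sum>i\<in>A. N (g i))"
  using assms(2)
proof (induction A rule: finite_induct)
  case empty
  then show ?case using is_norm_zero[OF assms(1)] by simp
next
  case (insert a A)
  have "N (g a + sum g A) \<le> N (g a) + N (sum g A)" using assms(1) by (simp add: is_norm_def)
  with insert show ?case by simp
qed

lemma is_norm_minus: "is_norm N \<Longrightarrow> N (- x) = N x"
  unfolding is_norm_def by (metis abs_minus_cancel abs_one mult_1 scaleR_minus1_left)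

lemma is_norm_upper:
  fixes N :: "'a::euclidean_space \<Rightarrow> real"
  assumes N: "is_norm N"
  obtains c where "0 < c" "\<And>x. N x \<le> c * norm x"
proof
  have nn: "0 \<le> N x" for x using N by (simp add: is_norm_def)
  show "0 < 1 + (\<Sum>b\<in>Basis. N (b::'a))" using nn by (simp add: add_pos_nonneg sum_nonneg)
  fix x :: 'a
  have "N x = N (\<Sum>b\<in>Basis. (x \<bullet> b) *\<^sub>R b)" by (simp add: euclidean_representation)
  also have "\<dots> \<le> (\<Sum>b\<in>Basis. N ((x \<bullet> b) *\<^sub>R b))" by (rule is_norm_sum_le[OF N]) simp
  also have "\<dots> = (\<Sum>b\<in>Basis. \<bar>x \<bullet> b\<bar> * N b)" using N by (simp add: is_norm_def)
  also have "\<dots> \<le> (\<Sum>b\<in>Basis. norm x * N b)"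
    using nn by (intro sum_mono mult_right_mono) (auto simp: Basis_le_norm)
  also have "\<dots> \<le> (1 + (\<Sum>b\<in>Basis. N b)) * norm x"
    unfolding sum_distrib_left[symmetric] by (simp add: algebra_simps)
  finally show "N x \<le> (1 + (\<Sum>b\<in>Basis. N b)) * norm x" .
qed

lemma is_norm_continuous:
  fixes N :: "'a::euclidean_space \<Rightarrow> real"
  assumes N: "is_norm N"
  shows "continuous_on S N"
proof -
  obtain c where c: "0 < c" "\<And>x. N x \<le> c * norm x" using is_norm_upper[OF N] by blast
  have "N x - N y \<le> c * norm (x - y)" for x y
  proof -
    have "N ((x - y) + y) \<le> N (x - y) + N y" using N unfolding is_norm_def by blast
    then show ?thesis using c(2)[of "x - y"] by simp
  qed
  then have "\<bar>N x - N y\<bar> \<le> c * norm (x - y)" for x y by (smt (verit) norm_minus_commute)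
  then have "c-lipschitz_on S N" using c by (intro lipschitz_onI) (auto simp: dist_norm)
  then show ?thesis by (rule lipschitz_on_continuous_on)
qed

text \<open>The constant is the minimum of \<open>N\<close> on the Euclidean unit sphere, attained
  by compactness. It makes the supremum defining the dual norm finite and converts Euclidean
  remainders into remainders in terms of \<open>N\<close>.\<close>

lemma is_norm_lower:
  fixes N :: "'a::euclidean_space \<Rightarrow> real"
  assumes N: "is_norm N"
  obtains c where "0 < c" "\<And>x. c * norm x \<le> N x"
proof -
  have "sphere (0::'a) 1 \<noteq> {}" by simp
  then obtain z where z: "z \<in> sphere 0 1" "\<And>y. y \<in> sphere 0 1 \<Longrightarrow> N z \<le> N y"
    using continuous_attains_inf[OF compact_sphere _ is_norm_continuous[OF N]] by blast
  have nz: "0 \<le> N z" "N z \<noteq> 0" using N z(1) unfolding is_norm_def by auto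
  show thesis
  proof (rule that[of "N z"])
    show "0 < N z" using nz by simp
    fix x :: 'a
    show "N z * norm x \<le> N x"
    proof (cases "x = 0")
      case False
      then have "N z \<le> N ((1 / norm x) *\<^sub>R x)" by (intro z(2)) simp
      also have "\<dots> = N x / norm x" using N by (simp add: is_norm_def)
      finally show ?thesis using False by (simp add: field_simps)
    qed (use N in \<open>simp add: is_norm_def\<close>)
  qed
qed

section \<open>The dual norm and nearly optimal directions\<close>

context
  fixes N :: "'a::euclidean_space \<Rightarrow> real" and c :: real
  assumes N: "is_norm N" and c: "0 < c" "\<And>x. c * norm x \<le> N x"
begin

lemma inner_le_of_unit_ball:
  assumes "N x \<le> 1" shows "x \<bullet> y \<le> norm y / c"
proof -
  have "c * norm x \<le> 1" using c(2)[of x] assms by simp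
  then have "norm x \<le> 1 / c" using c(1) by (simp add: field_simps)
  then have "norm x * norm y \<le> (1 / c) * norm y" by (intro mult_right_mono) auto
  then show ?thesis using norm_cauchy_schwarz[of x y] by simp
qed

lemma dual_norm_upper: "N x \<le> 1 \<Longrightarrow> x \<bullet> y \<le> dual_norm N y"
  unfolding dual_norm_def
  by (rule cSUP_upper) (auto intro!: bdd_aboveI2[where M = "norm y / c"] inner_le_of_unit_ball)

lemma zero_in_unit_ball: "N 0 \<le> 1"
  using is_norm_zero[OF N] by simp

lemma dual_norm_least: "(\<And>x. N x \<le> 1 \<Longrightarrow> x \<bullet> y \<le> b) \<Longrightarrow> dual_norm N y \<le> b"
  unfolding dual_norm_def using zero_in_unit_ball by (intro cSUP_least) auto

lemma dual_norm_nonneg: "0 \<le> dual_norm N y"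
  using dual_norm_upper[OF zero_in_unit_ball] by simp

lemma dual_norm_le: "dual_norm N y \<le> norm y / c"
  by (rule dual_norm_least) (rule inner_le_of_unit_ball)

lemma inner_le_dual_norm: "\<bar>x \<bullet> y\<bar> \<le> N x * dual_norm N y"
proof -
  have 1: "x \<bullet> y \<le> N x * dual_norm N y" for x
  proof (cases "x = 0")
    case False
    then have pos: "0 < N x" using N by (metis is_norm_def less_eq_real_def)
    then have "N ((1 / N x) *\<^sub>R x) \<le> 1" using N by (simp add: is_norm_def)
    from dual_norm_upper[OF this, of y] show ?thesis using pos by (simp add: field_simps)
  qed (use is_norm_zero[OF N] in simp)
  show ?thesis using 1[of x] 1[of "- x"] is_norm_minus[OF N, of x] by simp
qed

lemma dual_norm_continuous: "continuous_on S (dual_norm N)"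
proof -
  have 1: "dual_norm N y - dual_norm N z \<le> (1 / c) * norm (y - z)" for y z
  proof -
    have "dual_norm N y \<le> dual_norm N z + norm (y - z) / c"
    proof (rule dual_norm_least)
      fix x assume x: "N x \<le> 1"
      show "x \<bullet> y \<le> dual_norm N z + norm (y - z) / c"
        using dual_norm_upper[OF x, of z] inner_le_of_unit_ball[OF x, of "y - z"] by (simp add: inner_diff_right)
    qed
    then show ?thesis by simp
  qed
  have "\<bar>dual_norm N y - dual_norm N z\<bar> \<le> (1 / c) * norm (y - z)" for y z
    using 1[of y z] 1[of z y] by (simp add: abs_le_iff norm_minus_commute)
  then have "(1 / c)-lipschitz_on S (dual_norm N)"
    using c(1) by (intro lipschitz_onI) (auto simp: dist_norm)
  then show ?thesis by (rule lipschitz_on_continuous_on)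
qed

lemma dual_norm_measurable [measurable]: "dual_norm N \<in> borel_measurable borel"
  by (intro borel_measurable_continuous_onI dual_norm_continuous)

text \<open>An exact maximizer would call for a measurable selection theorem. The loss \<eta> makes
  the set of good directions an open half-space that meets the unit ball, hence also a countable
  dense subset of it; the first good member of an enumeration then depends measurably on
  \<open>x\<close>.\<close>

lemma dual_norm_selection:
  assumes G [measurable]: "G \<in> borel_measurable M" and \<eta>: "0 < \<eta>"
  obtains v where "v \<in> borel_measurable M" "\<And>x. N (v x) \<le> 1"
    "\<And>x. (1 - \<eta>) * dual_norm N (G x) \<le> v x \<bullet> G x"
proof -
  obtain S where S: "countable S" "S \<subseteq> {x. N x \<le> 1}" "{x. N x \<le> 1} \<subseteq> closure S"
    using separable by blast
  have ne: "S \<noteq> {}" using S(3) zero_in_unit_ball by auto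
  define w where "w = from_nat_into S"
  have w: "w n \<in> S" for n unfolding w_def using ne by (rule from_nat_into)
  have ex: "\<exists>n. (1 - \<eta>) * dual_norm N g \<le> w n \<bullet> g" for g
  \<comment> \<open>The strict inequality defining the half-space has no solution in the unit ball
    when the dual norm is 0; then every direction has inner product 0 with \<open>g\<close> and the
    first one is good.\<close>
  proof (cases "dual_norm N g = 0")
    case True
    have "\<bar>w 0 \<bullet> g\<bar> \<le> N (w 0) * dual_norm N g" by (rule inner_le_dual_norm)
    with True show ?thesis by (intro exI[of _ 0]) simp
  next
    case False
    then have pos: "0 < dual_norm N g" using dual_norm_nonneg[of g] by simp
    have "\<exists>x. N x \<le> 1 \<and> (1 - \<eta>) * dual_norm N g < x \<bullet> g"
    proof (rule ccontr)
      assume "\<not> ?thesis"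
      then have "dual_norm N g \<le> (1 - \<eta>) * dual_norm N g"
        by (intro dual_norm_least) (auto simp: not_less)
      then show False using mult_pos_pos[OF \<eta> pos] by (simp add: algebra_simps)
    qed
    then obtain x where x: "N x \<le> 1" "x \<in> {x. g \<bullet> x > (1 - \<eta>) * dual_norm N g}" by (auto simp: inner_commute)
    have "open {x. g \<bullet> x > (1 - \<eta>) * dual_norm N g}" by (rule open_halfspace_gt)
    moreover have "x \<in> closure S" using S(3) x(1) by auto
    ultimately have "S \<inter> {x. g \<bullet> x > (1 - \<eta>) * dual_norm N g} \<noteq> {}"
      using x(2) open_Int_closure_eq_empty by fastforce
    then obtain y where "y \<in> S" "(1 - \<eta>) * dual_norm N g < y \<bullet> g" by (auto simp: inner_commute)
    then show ?thesis using from_nat_into_surj[OF S(1)] unfolding w_def by (metis less_eq_real_def)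
  qed
  define v where "v x = w (LEAST n. (1 - \<eta>) * dual_norm N (G x) \<le> w n \<bullet> G x)" for x
  show thesis
  proof (rule that[of v])
    have [measurable]: "(\<lambda>x. LEAST n. (1 - \<eta>) * dual_norm N (G x) \<le> w n \<bullet> G x) \<in> M \<rightarrow>\<^sub>M count_space UNIV"
      by measurable
    show "v \<in> borel_measurable M" unfolding v_def by measurable
    show "N (v x) \<le> 1" for x using w S(2) by (auto simp: v_def)
    show "(1 - \<eta>) * dual_norm N (G x) \<le> v x \<bullet> G x" for x
      unfolding v_def using ex by (rule LeastI_ex)
  qed
qed

end

text \<open>Moves from extended to ordinary real exponents. \<open>q = \<infinity>\<close> would
  force \<open>1 / P = 1\<close>, contradicting \<open>2 \<le> p\<close>, and \<open>q = 0\<close>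
  would make \<open>1 / q\<close> infinite.\<close>

lemma conjugate_exponents_cases:
  assumes "2 \<le> p" "1 / p + 1 / q = (1::ennreal)"
  obtains "p = \<infinity>" "q = 1"
  | P Q where "p = ennreal P" "q = ennreal Q" "2 \<le> P" "1 < Q" "1 / P + 1 / Q = 1"
proof (cases p)
  case top
  then have *: "1 / q = 1" using assms(2) by simp
  have "q = 1"
  proof (cases q)
    case (real r)
    then show ?thesis using * by (cases "r = 0") (auto simp: divide_ennreal ennreal_1[symmetric] simp del: ennreal_1)
  qed (use * in simp)
  with top that(1) show thesis by simp
next
  case (real P)
  have "ennreal 2 \<le> ennreal P" using assms(1) real by simp
  then have P: "2 \<le> P" using real(1) by (subst (asm) ennreal_le_iff) auto
  have pd: "1 / p = ennreal (1 / P)" using real P divide_ennreal[of 1 P] by simp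
  show thesis
  proof (cases q)
    case top
    then have "ennreal (1 / P) = ennreal 1" using assms(2) pd by simp
    then show ?thesis using P by (subst (asm) ennreal_inj) auto
  next
    case q: (real Q)
    have "Q \<noteq> 0"
    proof
      assume "Q = 0"
      then have "1 / q = top" using q by simp
      then show False using assms(2) by simp
    qed
    then have Q: "0 < Q" using q by simp
    have "1 / q = ennreal (1 / Q)" using q Q divide_ennreal[of 1 Q] by simp
    then have "ennreal (1 / P + 1 / Q) = ennreal 1" using assms(2) pd P Q by simp
    then have e: "1 / P + 1 / Q = 1" using P Q by (subst (asm) ennreal_inj) auto
    have "0 < 1 / P" using P by simp
    then have "1 / Q < 1" using e by linarith
    then have "1 < Q" using Q by (simp add: field_simps)
    then show ?thesis using that(2) real q P e by blast
  qed
qed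

text \<open>Young's inequality for \<open>a / e\<close> and \<open>b / B\<close>, scaled by
  \<open>e * B\<close> and integrated, where \<open>B\<close> is the norm of \<open>b\<close> and
  \<open>e\<close> merely bounds the norm of \<open>a\<close>. If \<open>B = 0\<close>, the division
  is meaningless, but then \<open>b\<close> vanishes almost everywhere.\<close>

lemma Holder_inequality:
  fixes a b :: "'b \<Rightarrow> real"
  assumes PQ: "1 < P" "1 < Q" "1 / P + 1 / Q = 1"
    and m [measurable]: "a \<in> borel_measurable M" "b \<in> borel_measurable M"
    and nn: "\<And>x. 0 \<le> a x" "\<And>x. 0 \<le> b x"
    and a: "integrable M (\<lambda>x. a x powr P)" "(\<integral>x. a x powr P \<partial>M) \<le> e powr P" and e: "0 < e"
    and b: "integrable M (\<lambda>x. b x powr Q)"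
  shows "integrable M (\<lambda>x. b x * a x)" "(\<integral>x. b x * a x \<partial>M) \<le> e * (\<integral>x. b x powr Q \<partial>M) powr (1 / Q)"
proof -
  define B where "B = (\<integral>x. b x powr Q \<partial>M) powr (1 / Q)"
  have I0: "0 \<le> (\<integral>x. b x powr Q \<partial>M)" by simp
  have "integrable M (\<lambda>x. b x * a x) \<and> (\<integral>x. b x * a x \<partial>M) \<le> e * B"
  proof (cases "(\<integral>x. b x powr Q \<partial>M) = 0")
    case True
    then have "AE x in M. b x powr Q = 0"
      using integral_nonneg_eq_0_iff_AE[OF b] by simp
    then have ae: "AE x in M. b x * a x = 0" by eventually_elim simp
    then have "integrable M (\<lambda>x. b x * a x)" by (subst integrable_cong_AE[where g = "\<lambda>_. 0"]) auto
    moreover have "(\<integral>x. b x * a x \<partial>M) = 0" using ae by (subst integral_cong_AE[where g = "\<lambda>_. 0"]) auto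
    ultimately show ?thesis using e by (simp add: B_def)
  next
    case False
    then have B: "0 < B" using I0 by (simp add: B_def)
    have BQ: "B powr Q = (\<integral>x. b x powr Q \<partial>M)" using PQ by (simp add: B_def powr_powr)
    let ?h = "\<lambda>x. e * B * (a x powr P / (e powr P) / P + b x powr Q / (B powr Q) / Q)"
    have le: "b x * a x \<le> ?h x" for x
    proof -
      have "(a x / e) * (b x / B) \<le> (a x / e) powr P / P + (b x / B) powr Q / Q"
        by (rule Youngs_inequality) (use PQ nn e B in auto)
      then have "(e * B) * ((a x / e) * (b x / B)) \<le> (e * B) * ((a x / e) powr P / P + (b x / B) powr Q / Q)"
        using e B by (intro mult_left_mono) auto
      then show ?thesis using e B nn by (simp add: powr_divide mult_ac)
    qed
    have ih: "integrable M ?h" using a(1) b by (intro integrable_mult_right Bochner_Integration.integrable_add integrable_divide)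
    have i: "integrable M (\<lambda>x. b x * a x)"
      by (rule Bochner_Integration.integrable_bound[OF ih])
        (use le nn in \<open>auto intro!: AE_I2 order_trans[OF _ abs_ge_self]\<close>)
    have "(\<integral>x. b x * a x \<partial>M) \<le> (\<integral>x. ?h x \<partial>M)" using i ih le by (intro integral_mono) auto
    also have "\<dots> = e * B * ((\<integral>x. a x powr P \<partial>M) / e powr P / P + (\<integral>x. b x powr Q \<partial>M) / B powr Q / Q)"
      using a(1) b by simp
    also have "\<dots> \<le> e * B * (1 / P + 1 / Q)"
      using a(2) e B PQ False by (intro mult_left_mono add_mono divide_right_mono) (auto simp: BQ[symmetric])
    finally show ?thesis using i PQ by simp
  qed
  then show "integrable M (\<lambda>x. b x * a x)" "(\<integral>x. b x * a x \<partial>M) \<le> e * (\<integral>x. b x powr Q \<partial>M) powr (1 / Q)"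
    by (auto simp: B_def)
qed

section \<open>Seminorms of order p\<close>

text \<open>The complement of the support is a union of open null sets, and by second countability
  countably many of them suffice. This turns bounded support into an almost sure bound on the
  initial point.\<close>

lemma AE_measure_support:
  fixes \<mu> :: "'a::second_countable_topology measure"
  assumes "sets \<mu> = sets borel"
  shows "AE x in \<mu>. x \<in> measure_support \<mu>"
proof -
  define F where "F = {U. open U \<and> emeasure \<mu> U = 0}"
  obtain F' where F': "F' \<subseteq> F" "countable F'" "\<Union>F' = \<Union>F"
    using Lindelof[of F] by (auto simp: F_def)
  have "\<Union>F' \<in> null_sets \<mu>"
  proof (rule null_sets_UN'[OF F'(2), of "\<lambda>U. U", simplified])
    fix U assume "U \<in> F'"
    then have "open U" "emeasure \<mu> U = 0" using F'(1) by (auto simp: F_def)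
    then show "U \<in> null_sets \<mu>" using assms by (simp add: null_sets_def)
  qed
  moreover have "{x \<in> space \<mu>. x \<notin> measure_support \<mu>} \<subseteq> \<Union>F"
    by (auto simp: measure_support_def F_def zero_less_iff_neq_zero)
  ultimately show ?thesis using F'(3) by (auto intro: AE_I')
qed

lemma Lp_seminorm_finiteD:
  assumes P: "1 \<le> P" and g [measurable]: "g \<in> borel_measurable M" and e: "0 \<le> e"
    and le: "Lp_seminorm (ennreal P) M g \<le> ennreal e"
  shows "integrable M (\<lambda>x. \<bar>g x\<bar> powr P)" "(\<integral>x. \<bar>g x\<bar> powr P \<partial>M) \<le> e powr P"
proof -
  define I where "I = (\<integral>\<^sup>+x. ennreal (\<bar>g x\<bar> powr P) \<partial>M)"
  have nI: "I \<noteq> \<infinity>" using le P by (auto simp: Lp_seminorm_def I_def Let_def top_unique split: if_splits)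
  then have "ennreal (enn2real I powr (1 / P)) \<le> ennreal e"
    using le P by (simp add: Lp_seminorm_def I_def Let_def)
  then have "enn2real I powr (1 / P) \<le> e" using e by simp
  then have "(enn2real I powr (1 / P)) powr P \<le> e powr P" using P by (intro powr_mono2) auto
  then have 1: "enn2real I \<le> e powr P" using P by (simp add: powr_powr)
  show "integrable M (\<lambda>x. \<bar>g x\<bar> powr P)"
    by (rule integrableI_nonneg) (use nI in \<open>auto simp: I_def less_top\<close>)
  have "(\<integral>x. \<bar>g x\<bar> powr P \<partial>M) = enn2real I"
    unfolding I_def by (rule integral_eq_nn_integral) auto
  with 1 show "(\<integral>x. \<bar>g x\<bar> powr P \<partial>M) \<le> e powr P" by simp
qed

lemma Lp_seminorm_finiteI:
  assumes P: "1 \<le> P" and e: "0 \<le> e"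
    and int: "integrable M (\<lambda>x. \<bar>g x\<bar> powr P)" and le: "(\<integral>x. \<bar>g x\<bar> powr P \<partial>M) \<le> e powr P"
  shows "Lp_seminorm (ennreal P) M g \<le> ennreal e"
proof -
  define i where "i = (\<integral>x. \<bar>g x\<bar> powr P \<partial>M)"
  have i: "(\<integral>\<^sup>+x. ennreal (\<bar>g x\<bar> powr P) \<partial>M) = ennreal i" "0 \<le> i"
    unfolding i_def by (auto intro: nn_integral_eq_integral[OF int])
  have "i powr (1 / P) \<le> (e powr P) powr (1 / P)" using le P i(2) by (intro powr_mono2) (auto simp: i_def)
  then have "i powr (1 / P) \<le> e" using P e by (simp add: powr_powr)
  then show ?thesis using P i by (simp add: Lp_seminorm_def Let_def ennreal_leI)
qed

lemma Lp_seminorm_infinityD: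
  assumes "Lp_seminorm \<infinity> M g \<le> ennreal e" "0 \<le> e"
  shows "AE x in M. \<bar>g x\<bar> \<le> e"
  using esssup_AE[of "\<lambda>x. ennreal \<bar>g x\<bar>" M]
proof eventually_elim
  case (elim x)
  then have "ennreal \<bar>g x\<bar> \<le> ennreal e" using assms(1) by (simp add: Lp_seminorm_def)
  then show ?case using assms(2) by simp
qed

lemma Lp_seminorm_infinityI:
  assumes "g \<in> borel_measurable M" "AE x in M. \<bar>g x\<bar> \<le> e"
  shows "Lp_seminorm \<infinity> M g \<le> ennreal e"
  using assms by (auto simp: Lp_seminorm_def intro!: esssup_I ennreal_leI elim: eventually_mono)

lemma Lp_seminorm_distr_le:
  assumes T [measurable]: "T \<in> M \<rightarrow>\<^sub>M M'" and g [measurable]: "g \<in> borel_measurable M'"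
  shows "Lp_seminorm p (distr M M' T) g \<le> Lp_seminorm p M (\<lambda>x. g (T x))"
proof (cases "p = \<infinity>")
  case True
  have "esssup (distr M M' T) (\<lambda>z. ennreal \<bar>g z\<bar>) \<le> esssup M (\<lambda>x. ennreal \<bar>g (T x)\<bar>)"
  proof (rule esssup_I)
    have "AE x in M. ennreal \<bar>g (T x)\<bar> \<le> esssup M (\<lambda>x. ennreal \<bar>g (T x)\<bar>)" by (rule esssup_AE)
    then show "AE z in distr M M' T. ennreal \<bar>g z\<bar> \<le> esssup M (\<lambda>x. ennreal \<bar>g (T x)\<bar>)"
      by (subst AE_distr_iff) auto
  qed simp
  then show ?thesis using True by (simp add: Lp_seminorm_def)
next
  case False
  then show ?thesis by (simp add: Lp_seminorm_def nn_integral_distr)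
qed

section \<open>Moment and duality estimates for probability measures\<close>

context prob_space
begin

text \<open>Monotonicity of the norms of a probability space in their exponent: this is the use of
  \<open>p \<ge> 2\<close> that makes the remainder of second order.\<close>

lemma Lp_seminorm_second_moment:
  assumes p: "2 \<le> p" "1 / p + 1 / q = (1::ennreal)"
    and g [measurable]: "g \<in> borel_measurable M" and e: "0 < e"
    and le: "Lp_seminorm p M g \<le> ennreal e"
  shows "integrable M (\<lambda>x. (g x)\<^sup>2)" "(\<integral>x. (g x)\<^sup>2 \<partial>M) \<le> e\<^sup>2"
proof -
  have "integrable M (\<lambda>x. (g x)\<^sup>2) \<and> (\<integral>x. (g x)\<^sup>2 \<partial>M) \<le> e\<^sup>2"
    using p
  proof (cases rule: conjugate_exponents_cases)
    case 1
    then have ae: "AE x in M. \<bar>g x\<bar> \<le> e" using le e by (intro Lp_seminorm_infinityD) auto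
    then have ae2: "AE x in M. (g x)\<^sup>2 \<le> e\<^sup>2"
      by eventually_elim (use e in \<open>simp add: abs_le_square_iff[symmetric]\<close>)
    have i: "integrable M (\<lambda>x. (g x)\<^sup>2)" by (rule integrable_const_bound[where B = "e\<^sup>2"]) (use ae2 in auto)
    with ae2 show ?thesis using integral_le_const[OF i] by simp
  next
    case (2 P Q)
    have i: "integrable M (\<lambda>x. \<bar>g x\<bar> powr P)" "(\<integral>x. \<bar>g x\<bar> powr P \<partial>M) \<le> e powr P"
      using Lp_seminorm_finiteD[of P g M e] 2 le e by auto
    \<comment> \<open>Weighted arithmetic-geometric mean of
      \<open>(\<bar>g x\<bar> / e) powr P\<close> and 1 with weights \<open>2 / P\<close> and
      \<open>1 - 2 / P\<close>. The weights sum to 1, so the majorant integrates to at most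
      \<open>e\<^sup>2\<close>.\<close>
    let ?h = "\<lambda>x. e\<^sup>2 * (2 / P * (\<bar>g x\<bar> powr P / e powr P) + (1 - 2 / P))"
    have h: "(g x)\<^sup>2 \<le> ?h x" for x
    proof (cases "g x = 0")
      case False
      let ?a = "(\<bar>g x\<bar> / e) powr P"
      have a: "0 < ?a" using False e by simp
      have "?a powr (2 / P) * 1 powr (1 - 2 / P) \<le> 2 / P * ?a + (1 - 2 / P) * 1"
        using 2 a by (intro Youngs_inequality_0) (auto simp: field_simps)
      moreover have "?a powr (2 / P) = (\<bar>g x\<bar> / e) powr 2" using 2 by (simp add: powr_powr)
      also have "\<dots> = (g x)\<^sup>2 / e\<^sup>2" using False e by (simp add: power_divide)
      ultimately have "(g x)\<^sup>2 / e\<^sup>2 \<le> 2 / P * ?a + (1 - 2 / P)" by simp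
      then have "e\<^sup>2 * ((g x)\<^sup>2 / e\<^sup>2) \<le> e\<^sup>2 * (2 / P * ?a + (1 - 2 / P))" by (intro mult_left_mono) auto
      then show ?thesis using e by (simp add: powr_divide)
    qed (use 2 in auto)
    have ih: "integrable M ?h"
      using i(1) by (intro integrable_mult_right Bochner_Integration.integrable_add integrable_divide integrable_const)
    have ig: "integrable M (\<lambda>x. (g x)\<^sup>2)"
      by (rule Bochner_Integration.integrable_bound[OF ih]) (use h in \<open>auto intro!: AE_I2 order_trans[OF _ abs_ge_self]\<close>)
    have "(\<integral>x. (g x)\<^sup>2 \<partial>M) \<le> (\<integral>x. ?h x \<partial>M)" by (rule integral_mono[OF ig ih h])
    also have "\<dots> = e\<^sup>2 * (2 / P * ((\<integral>x. \<bar>g x\<bar> powr P \<partial>M) / e powr P) + (1 - 2 / P))"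
      using i(1) by (simp add: prob_space)
    also have "\<dots> \<le> e\<^sup>2 * (2 / P * 1 + (1 - 2 / P))"
      using i(2) e 2 by (intro mult_left_mono add_mono) (auto simp: divide_le_eq)
    finally show ?thesis using ig by simp
  qed
  then show "integrable M (\<lambda>x. (g x)\<^sup>2)" "(\<integral>x. (g x)\<^sup>2 \<partial>M) \<le> e\<^sup>2" by auto
qed

lemma integrable_powr_bounded:
  fixes D :: "'a \<Rightarrow> real"
  assumes "D \<in> borel_measurable M" "AE x in M. 0 \<le> D x \<and> D x \<le> b" "0 \<le> r"
  shows "integrable M (\<lambda>x. D x powr r)"
proof (rule integrable_const_bound[where B = "b powr r"])
  show "AE x in M. norm (D x powr r) \<le> b powr r"
    using assms(2) by eventually_elim (use assms(3) in \<open>auto intro: powr_mono2\<close>)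
qed (use assms(1) in measurable)

lemma Lp_seminorm_Holder:
  assumes p: "2 \<le> p" "1 / p + 1 / q = (1::ennreal)"
    and g [measurable]: "g \<in> borel_measurable M" and e: "0 < e"
    and le: "Lp_seminorm p M g \<le> ennreal e"
    and D [measurable]: "D \<in> borel_measurable M" "\<And>x. 0 \<le> D x" "AE x in M. D x \<le> b"
  shows "integrable M (\<lambda>x. D x * \<bar>g x\<bar>)"
    "(\<integral>x. D x * \<bar>g x\<bar> \<partial>M) \<le> e * (\<integral>x. D x powr enn2real q \<partial>M) powr (1 / enn2real q)"
proof -
  have "integrable M (\<lambda>x. D x * \<bar>g x\<bar>) \<and>
    (\<integral>x. D x * \<bar>g x\<bar> \<partial>M) \<le> e * (\<integral>x. D x powr enn2real q \<partial>M) powr (1 / enn2real q)"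
    using p
  proof (cases rule: conjugate_exponents_cases)
    case 1
    then have ae: "AE x in M. \<bar>g x\<bar> \<le> e" using le e by (intro Lp_seminorm_infinityD) auto
    have iD: "integrable M D" by (rule integrable_const_bound[where B = b]) (use D in auto)
    have ae2: "AE x in M. D x * \<bar>g x\<bar> \<le> D x * e"
      using ae by eventually_elim (use D(2) in \<open>auto intro: mult_left_mono\<close>)
    have i: "integrable M (\<lambda>x. D x * \<bar>g x\<bar>)"
      by (rule Bochner_Integration.integrable_bound[of M "\<lambda>x. D x * e"])
        (use iD ae2 D(2) e in \<open>auto simp: abs_mult elim!: eventually_mono\<close>)
    have "(\<integral>x. D x * \<bar>g x\<bar> \<partial>M) \<le> (\<integral>x. D x * e \<partial>M)"
      using i iD ae2 by (intro integral_mono_AE) auto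
    then show ?thesis using i 1 D(2) by (simp add: mult.commute)
  next
    case (2 P Q)
    have i: "integrable M (\<lambda>x. \<bar>g x\<bar> powr P)" "(\<integral>x. \<bar>g x\<bar> powr P \<partial>M) \<le> e powr P"
      using Lp_seminorm_finiteD[of P g M e] 2 le e by auto
    have "integrable M (\<lambda>x. D x powr Q)" using D 2 by (intro integrable_powr_bounded[where b = b]) auto
    then show ?thesis
      using Holder_inequality[of P Q "\<lambda>x. \<bar>g x\<bar>" M D e] i 2 e D by simp
  qed
  then show "integrable M (\<lambda>x. D x * \<bar>g x\<bar>)"
    "(\<integral>x. D x * \<bar>g x\<bar> \<partial>M) \<le> e * (\<integral>x. D x powr enn2real q \<partial>M) powr (1 / enn2real q)" by auto
qed

text \<open>For finite \<open>p\<close> the witness is \<open>D\<close> to the power \<open>q - 1\<close>, normalised in the \<open>p\<close>-norm; if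
  \<open>D = 0\<close> almost everywhere, the division by \<open>0\<close> gives \<open>s = 0\<close>, which is still correct.\<close>

lemma Holder_equality_case:
  assumes p: "2 \<le> p" "1 / p + 1 / q = (1::ennreal)"
    and D [measurable]: "D \<in> borel_measurable M" "\<And>x. 0 \<le> D x" "AE x in M. D x \<le> b"
  obtains s where "s \<in> borel_measurable M" "\<And>x. 0 \<le> s x"
    "\<And>g \<delta>. g \<in> borel_measurable M \<Longrightarrow> 0 \<le> \<delta> \<Longrightarrow> (\<And>x. \<bar>g x\<bar> \<le> \<delta> * s x) \<Longrightarrow> Lp_seminorm p M g \<le> ennreal \<delta>"
    "integrable M (\<lambda>x. s x * D x)"
    "(\<integral>x. s x * D x \<partial>M) = (\<integral>x. D x powr enn2real q \<partial>M) powr (1 / enn2real q)"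
  using p
proof (cases rule: conjugate_exponents_cases)
  case 1
  have iD: "integrable M D" by (rule integrable_const_bound[where B = b]) (use D in auto)
  \<comment> \<open>For \<open>p = \<infinity>\<close> every step may have full length, and
    \<open>q = 1\<close> makes the right-hand side the plain mean of \<open>D\<close>.\<close>
  show thesis
    by (rule that[of "\<lambda>_. 1"]) (use iD D(2) 1 in \<open>auto intro: Lp_seminorm_infinityI[unfolded infinity_ennreal_def]\<close>)
next
  case (2 P Q)
  define I where "I = (\<integral>x. D x powr Q \<partial>M)"
  have I: "0 \<le> I" by (simp add: I_def)
  have iD: "integrable M (\<lambda>x. D x powr Q)" using D 2 by (intro integrable_powr_bounded[where b = b]) auto
  have PQ: "(Q - 1) * P = Q" "1 - 1 / P = 1 / Q" using 2 by (auto simp: field_simps)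
  define s where "s x = D x powr (Q - 1) / I powr (1 / P)" for x
  have sD: "s x * D x = D x powr Q / I powr (1 / P)" for x
    using D(2)[of x] by (cases "D x = 0") (auto simp: s_def powr_diff)
  show thesis
  proof (rule that[of s])
    show [measurable]: "s \<in> borel_measurable M" unfolding s_def by measurable
    show s0: "0 \<le> s x" for x by (simp add: s_def)
    show "integrable M (\<lambda>x. s x * D x)" unfolding sD using iD by (rule integrable_divide)
    show "(\<integral>x. s x * D x \<partial>M) = (\<integral>x. D x powr enn2real q \<partial>M) powr (1 / enn2real q)"
    proof -
      have "(\<integral>x. s x * D x \<partial>M) = I / I powr (1 / P)" unfolding sD I_def by simp
      also have "\<dots> = I powr (1 - 1 / P)" using I by (cases "I = 0") (auto simp: powr_diff)
      finally show ?thesis using 2 PQ by (simp add: I_def)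
    qed
    fix g :: "'a \<Rightarrow> real" and \<delta> :: real
    assume g [measurable]: "g \<in> borel_measurable M" and \<delta>: "0 \<le> \<delta>" and le: "\<And>x. \<bar>g x\<bar> \<le> \<delta> * s x"
    \<comment> \<open>By \<open>(Q - 1) * P = Q\<close>, the integral of \<open>s powr P\<close> is
      \<open>I / I\<close>, which is 1, or 0 if \<open>I = 0\<close>; in both cases a step of at
      most \<open>\<delta> * s\<close> has cost at most \<delta>.\<close>
    have sP: "(\<delta> * s x) powr P = \<delta> powr P * (D x powr Q / I)" for x
      using \<delta> s0[of x] I 2 PQ(1) by (simp add: powr_mult s_def powr_divide powr_powr)
    have b: "\<bar>g x\<bar> powr P \<le> \<delta> powr P * (D x powr Q / I)" for x
      using powr_mono2[of P "\<bar>g x\<bar>" "\<delta> * s x"] le[of x] 2 unfolding sP by simp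
    have ib: "integrable M (\<lambda>x. \<delta> powr P * (D x powr Q / I))"
      using iD by (intro integrable_mult_right integrable_divide)
    have ig: "integrable M (\<lambda>x. \<bar>g x\<bar> powr P)"
      by (rule Bochner_Integration.integrable_bound[OF ib]) (use b I in \<open>auto intro!: AE_I2 order_trans[OF _ abs_ge_self]\<close>)
    have "(\<integral>x. \<bar>g x\<bar> powr P \<partial>M) \<le> (\<integral>x. \<delta> powr P * (D x powr Q / I) \<partial>M)"
      by (rule integral_mono[OF ig ib b])
    also have "\<dots> = \<delta> powr P * (I / I)" by (simp add: I_def)
    also have "\<dots> \<le> \<delta> powr P" by (cases "I = 0") auto
    finally show "Lp_seminorm p M g \<le> ennreal \<delta>"
      using Lp_seminorm_finiteI[OF _ \<delta> ig] 2 by simp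
  qed
qed

end

section \<open>First-order expansion over Wasserstein balls\<close>

text \<open>\<open>couplings\<close> fixes only the \<sigma>-algebra and the marginals; that the
  total mass is 1 is inherited from the first marginal.\<close>

lemma couplingD:
  fixes \<mu> \<nu> :: "'a::euclidean_space measure"
  assumes "prob_space \<mu>" "\<pi> \<in> couplings \<mu> \<nu>"
  shows "prob_space \<pi>" "sets \<pi> = sets (borel \<Otimes>\<^sub>M borel)" "fst \<in> \<pi> \<rightarrow>\<^sub>M borel" "snd \<in> \<pi> \<rightarrow>\<^sub>M borel"
    "\<mu> = distr \<pi> borel fst" "\<nu> = distr \<pi> borel snd"
proof -
  show s: "sets \<pi> = sets (borel \<Otimes>\<^sub>M borel)" and d: "\<mu> = distr \<pi> borel fst" "\<nu> = distr \<pi> borel snd"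
    using assms(2) by (auto simp: couplings_def)
  show f: "fst \<in> \<pi> \<rightarrow>\<^sub>M borel" and "snd \<in> \<pi> \<rightarrow>\<^sub>M borel"
    by (simp_all add: measurable_cong_sets[OF s refl])
  show "prob_space \<pi>" using assms(1) prob_space_distrD[OF f] unfolding d by blast
qed

text \<open>The data of the expansion: only the initial points are confined to a ball, the quadratic
  remainder bound holds for arbitrary end points.\<close>

locale quadratic_expansion =
  fixes p q :: ennreal and N :: "'a::euclidean_space \<Rightarrow> real" and \<mu> :: "'a measure"
    and j :: "'a \<Rightarrow> real" and G :: "'a \<Rightarrow> 'a" and c C R :: real
  assumes p: "2 \<le> p" "1 / p + 1 / q = 1"
    and N: "is_norm N" and c: "0 < c" "\<And>x. c * norm x \<le> N x"
    and \<mu>: "borel_prob \<mu>" and supp: "AE x in \<mu>. norm x \<le> R"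
    and C: "0 \<le> C"
    and j_cont: "continuous_on UNIV j"
    and G_meas [measurable]: "G \<in> borel_measurable borel"
    and rem: "\<And>x y. norm x \<le> R \<Longrightarrow> \<bar>j y - j x - G x \<bullet> (y - x)\<bar> \<le> C * (norm (y - x))\<^sup>2"
    and G_le: "\<And>x. norm x \<le> R \<Longrightarrow> norm (G x) \<le> C"
begin

definition "D x = dual_norm N (G x)"
text \<open>The right derivative at radius 0 that the expansion predicts for the worst-case
  cost.\<close>

definition "slope = (\<integral>x. D x powr enn2real q \<partial>\<mu>) powr (1 / enn2real q)"
text \<open>The remainder constant once displacements are measured by \<open>N\<close> instead of
  the Euclidean norm.\<close>

definition "K = C / c\<^sup>2"

lemma meas [measurable]:
  "N \<in> borel_measurable borel" "j \<in> borel_measurable borel" "D \<in> borel_measurable borel"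
proof -
  show "N \<in> borel_measurable borel" "j \<in> borel_measurable borel"
    by (intro borel_measurable_continuous_onI is_norm_continuous[OF N] j_cont)+
  note [measurable] = dual_norm_measurable[OF N c]
  show "D \<in> borel_measurable borel" unfolding D_def by measurable
qed

lemma prob: "prob_space \<mu>" and sets_\<mu> [measurable_cong, simp]: "sets \<mu> = sets borel"
  using \<mu> by (auto simp: borel_prob_def)

lemma N_nonneg: "0 \<le> N x" using N by (simp add: is_norm_def)

lemma K_nonneg: "0 \<le> K" using C c by (simp add: K_def)

lemma D_nonneg: "0 \<le> D x" unfolding D_def by (rule dual_norm_nonneg[OF N c])

lemma D_le: "norm x \<le> R \<Longrightarrow> D x \<le> C / c"
  using dual_norm_le[OF N c, of "G x"] divide_right_mono[OF G_le[of x], of c] c(1) by (simp add: D_def)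

lemma remainder_le: 
  assumes "norm x \<le> R" shows "\<bar>j y - j x - G x \<bullet> (y - x)\<bar> \<le> K * (N (x - y))\<^sup>2"
proof -
  have "(c * norm (x - y))\<^sup>2 \<le> (N (x - y))\<^sup>2" using c by (intro power_mono) auto
  then have "(norm (y - x))\<^sup>2 \<le> (N (x - y))\<^sup>2 / c\<^sup>2"
    using c(1) by (simp add: power_mult_distrib pos_le_divide_eq norm_minus_commute mult.commute)
  then have "C * (norm (y - x))\<^sup>2 \<le> C * ((N (x - y))\<^sup>2 / c\<^sup>2)" using C by (rule mult_left_mono)
  with rem[OF assms, of y] show ?thesis by (simp add: K_def)
qed

text \<open>Both bounds below produce errors of size \<open>slope * \<delta>\<^sup>2\<close>; this
  estimate makes them uniform, as it involves only \<open>C\<close> and \<open>c\<close>.\<close>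

lemma slope_le: "slope \<le> C / c"
proof -
  interpret \<mu>: prob_space \<mu> by (rule prob)
  define Q where "Q = enn2real q"
  have Q: "0 < Q" using p by (cases rule: conjugate_exponents_cases) (auto simp: Q_def)
  have b: "AE x in \<mu>. D x \<le> C / c" using supp by eventually_elim (rule D_le)
  have "integrable \<mu> (\<lambda>x. D x powr Q)"
    using b D_nonneg Q by (intro \<mu>.integrable_powr_bounded[where b = "C / c"]) auto
  moreover have "AE x in \<mu>. D x powr Q \<le> (C / c) powr Q"
    using b by eventually_elim (use D_nonneg Q in \<open>auto intro: powr_mono2\<close>)
  ultimately have "(\<integral>x. D x powr Q \<partial>\<mu>) \<le> (C / c) powr Q" by (rule \<mu>.integral_le_const)
  then have "slope \<le> ((C / c) powr Q) powr (1 / Q)"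
    unfolding slope_def Q_def[symmetric] using Q by (intro powr_mono2) auto
  then show ?thesis using Q C c by (simp add: powr_powr)
qed

text \<open>Shared by both directions. The upper bound uses the two estimates for a nearly optimal
  plan; the lower bound uses the first estimate for one explicit plan whose linear term is computed
  from below.\<close>

lemma coupling_expansion:
  assumes \<pi>: "\<pi> \<in> couplings \<mu> \<nu>" and e: "0 < e"
    and cost: "Lp_seminorm p \<pi> (\<lambda>(x, y). N (x - y)) \<le> ennreal e"
  shows "\<bar>(\<integral>y. j y \<partial>\<nu>) - (\<integral>x. j x \<partial>\<mu>) - (\<integral>z. G (fst z) \<bullet> (snd z - fst z) \<partial>\<pi>)\<bar> \<le> K * e\<^sup>2"
    "\<bar>\<integral>z. G (fst z) \<bullet> (snd z - fst z) \<partial>\<pi>\<bar> \<le> e * slope"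
proof -
  note cD = couplingD[OF prob \<pi>]
  interpret prob_space \<pi> by (rule cD)
  note [measurable] = cD(3,4)
  define g where "g z = N (fst z - snd z)" for z :: "'a \<times> 'a"
  have g_eq: "g = (\<lambda>(x, y). N (x - y))" by (auto simp: g_def)
  have [measurable]: "g \<in> borel_measurable \<pi>" unfolding g_def by measurable
  have cost': "Lp_seminorm p \<pi> g \<le> ennreal e" using cost by (simp add: g_eq)
  have supp\<pi>: "AE z in \<pi>. norm (fst z) \<le> R"
    using supp unfolding cD(5) by (subst (asm) AE_distr_iff) auto
  then have Db: "AE z in \<pi>. D (fst z) \<le> C / c" by eventually_elim (rule D_le)
  have slope_eq: "slope = (\<integral>z. D (fst z) powr enn2real q \<partial>\<pi>) powr (1 / enn2real q)"
    unfolding slope_def by (subst cD(5), subst integral_distr) auto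
  have H: "integrable \<pi> (\<lambda>z. D (fst z) * \<bar>g z\<bar>)" "(\<integral>z. D (fst z) * \<bar>g z\<bar> \<partial>\<pi>) \<le> e * slope"
    using Lp_seminorm_Holder[OF p _ e cost' _ _ Db] D_nonneg by (auto simp: slope_eq)
  have g2: "integrable \<pi> (\<lambda>z. (g z)\<^sup>2)" "(\<integral>z. (g z)\<^sup>2 \<partial>\<pi>) \<le> e\<^sup>2"
    using Lp_seminorm_second_moment[OF p _ e cost'] by auto
  let ?L = "\<lambda>z. G (fst z) \<bullet> (snd z - fst z)"
  have L: "\<bar>?L z\<bar> \<le> D (fst z) * \<bar>g z\<bar>" for z
  proof -
    have "\<bar>(snd z - fst z) \<bullet> G (fst z)\<bar> \<le> N (snd z - fst z) * D (fst z)"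
      unfolding D_def by (rule inner_le_dual_norm[OF N c])
    also have "N (snd z - fst z) = g z" using is_norm_minus[OF N, of "fst z - snd z"] by (simp add: g_def)
    finally show ?thesis using N_nonneg by (simp add: inner_commute g_def mult.commute)
  qed
  have iL: "integrable \<pi> ?L"
    by (rule Bochner_Integration.integrable_bound[OF H(1)]) (use L D_nonneg in \<open>auto simp: abs_mult\<close>)
  have "\<bar>\<integral>z. ?L z \<partial>\<pi>\<bar> \<le> (\<integral>z. \<bar>?L z\<bar> \<partial>\<pi>)" by (rule integral_abs_bound)
  also have "\<dots> \<le> (\<integral>z. D (fst z) * \<bar>g z\<bar> \<partial>\<pi>)" using iL H(1) L by (intro integral_mono) auto
  finally show "\<bar>\<integral>z. ?L z \<partial>\<pi>\<bar> \<le> e * slope" using H(2) by simp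
  let ?r = "\<lambda>z. j (snd z) - j (fst z) - ?L z"
  have r: "AE z in \<pi>. \<bar>?r z\<bar> \<le> K * (g z)\<^sup>2"
    using supp\<pi> by eventually_elim (simp add: remainder_le g_def)
  have ir: "integrable \<pi> ?r"
    by (rule Bochner_Integration.integrable_bound[of \<pi> "\<lambda>z. K * (g z)\<^sup>2"])
      (use g2(1) r in \<open>auto elim!: eventually_mono intro: order_trans[OF _ abs_ge_self]\<close>)
  have "bounded (j ` cball 0 R)"
    by (intro compact_imp_bounded compact_continuous_image continuous_on_subset[OF j_cont]) auto
  then obtain b where "\<forall>x\<in>cball 0 R. \<bar>j x\<bar> \<le> b" by (auto simp: bounded_iff)
  then have b: "\<And>x. norm x \<le> R \<Longrightarrow> \<bar>j x\<bar> \<le> b" by simp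
  have ij: "integrable \<pi> (\<lambda>z. j (fst z))"
    by (rule integrable_const_bound[where B = b]) (use supp\<pi> b in \<open>auto elim!: eventually_mono\<close>)
  \<comment> \<open>Nothing is assumed about the integrability of \<open>j\<close> under
    \<open>\<nu>\<close>, whose support may be unbounded. It is recovered from the expansion: the
    remainder is dominated by the squared distance, \<open>j (fst z)\<close> is almost surely
    bounded, and Hoelder's inequality handles the linear term.\<close>
  have "integrable \<pi> (\<lambda>z. ?r z + j (fst z) + ?L z)"
    by (intro Bochner_Integration.integrable_add ir ij iL)
  then have ijs: "integrable \<pi> (\<lambda>z. j (snd z))" by simp
  have "(\<integral>y. j y \<partial>\<nu>) - (\<integral>x. j x \<partial>\<mu>) - (\<integral>z. ?L z \<partial>\<pi>) = (\<integral>z. ?r z \<partial>\<pi>)"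
  proof -
    have "(\<integral>y. j y \<partial>\<nu>) = (\<integral>z. j (snd z) \<partial>\<pi>)" by (subst cD(6), rule integral_distr) auto
    moreover have "(\<integral>y. j y \<partial>\<mu>) = (\<integral>z. j (fst z) \<partial>\<pi>)" by (subst cD(5), rule integral_distr) auto
    ultimately show ?thesis using ij ijs iL by simp
  qed
  also have "\<bar>\<dots>\<bar> \<le> (\<integral>z. \<bar>?r z\<bar> \<partial>\<pi>)" by (rule integral_abs_bound)
  also have "\<dots> \<le> (\<integral>z. K * (g z)\<^sup>2 \<partial>\<pi>)"
    using ir g2(1) r by (intro integral_mono_AE) auto
  also have "\<dots> \<le> K * e\<^sup>2" using g2(2) K_nonneg by (simp add: mult_left_mono)
  finally show "\<bar>(\<integral>y. j y \<partial>\<nu>) - (\<integral>x. j x \<partial>\<mu>) - (\<integral>z. ?L z \<partial>\<pi>)\<bar> \<le> K * e\<^sup>2" .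
qed

lemma worst_case_upper:
  assumes \<delta>: "0 < \<delta>" "\<delta> \<le> 1" and \<nu>: "\<nu> \<in> wasserstein_ball p N \<mu> \<delta>"
  shows "(\<integral>y. j y \<partial>\<nu>) \<le> (\<integral>x. j x \<partial>\<mu>) + \<delta> * slope + (C / c + 4 * K) * \<delta>\<^sup>2"
proof -
  \<comment> \<open>The infimum over couplings is not known to be attained, so a plan of cost
    strictly below a slightly larger \<open>e\<close> is taken. The excess
    \<open>\<delta>\<^sup>2\<close> adds only \<open>slope * \<delta>\<^sup>2\<close>, and
    \<open>e \<le> 2 * \<delta>\<close> gives the factor 4 of \<open>K\<close>.\<close>
  define e where "e = \<delta> + \<delta>\<^sup>2"
  have "\<delta>\<^sup>2 \<le> \<delta>" using \<delta> by (simp add: power2_eq_square mult_left_le)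
  then have e: "0 < e" "\<delta> < e" "e \<le> 2 * \<delta>" using \<delta> by (auto simp: e_def add_pos_pos)
  have "wasserstein p N \<mu> \<nu> \<le> ennreal \<delta>" using \<nu> by (simp add: wasserstein_ball_def)
  also have "\<dots> < ennreal e" using \<delta> e by (simp add: ennreal_less_iff)
  finally obtain \<pi> where \<pi>: "\<pi> \<in> couplings \<mu> \<nu>" "Lp_seminorm p \<pi> (\<lambda>(x, y). N (x - y)) < ennreal e"
    unfolding wasserstein_def by (auto simp: INF_less_iff)
  note ce = coupling_expansion[OF \<pi>(1) e(1) less_imp_le[OF \<pi>(2)]]
  have "(\<integral>y. j y \<partial>\<nu>) \<le> (\<integral>x. j x \<partial>\<mu>) + e * slope + K * e\<^sup>2" using ce by linarith
  also have "e * slope \<le> \<delta> * slope + \<delta>\<^sup>2 * (C / c)"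
    using mult_left_mono[OF slope_le, of "\<delta>\<^sup>2"] by (simp add: e_def distrib_right)
  also have "K * e\<^sup>2 \<le> K * (2 * \<delta>)\<^sup>2" using e K_nonneg by (intro mult_left_mono power_mono) auto
  finally show ?thesis by (simp add: algebra_simps power_mult_distrib)
qed

lemma worst_case_lower:
  assumes \<delta>: "0 < \<delta>" "\<delta> < 1"
  obtains \<nu> where "\<nu> \<in> wasserstein_ball p N \<mu> \<delta>"
    "(\<integral>x. j x \<partial>\<mu>) + \<delta> * slope - (C / c + K) * \<delta>\<^sup>2 \<le> (\<integral>y. j y \<partial>\<nu>)"
proof -
  interpret \<mu>: prob_space \<mu> by (rule prob)
  have Db: "AE x in \<mu>. D x \<le> C / c" using supp by eventually_elim (rule D_le)
  have [measurable]: "D \<in> borel_measurable \<mu>" by measurable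
  obtain s where s [measurable]: "s \<in> borel_measurable \<mu>" and s0: "\<And>x. 0 \<le> s x"
    and sLp: "\<And>g \<delta>. g \<in> borel_measurable \<mu> \<Longrightarrow> 0 \<le> \<delta> \<Longrightarrow> (\<And>x. \<bar>g x\<bar> \<le> \<delta> * s x) \<Longrightarrow> Lp_seminorm p \<mu> g \<le> ennreal \<delta>"
    and sD: "integrable \<mu> (\<lambda>x. s x * D x)" "(\<integral>x. s x * D x \<partial>\<mu>) = slope"
    unfolding slope_def
    by (rule \<mu>.Holder_equality_case[OF p \<open>D \<in> borel_measurable \<mu>\<close> D_nonneg Db]) blast
  \<comment> \<open>The relative loss of the direction is taken to be \<delta> itself: the linear
    gain drops from \<open>\<delta> * slope\<close> to
    \<open>\<delta> * (1 - \<delta>) * slope\<close>, a second-order loss.\<close>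
  obtain v where v [measurable]: "v \<in> borel_measurable borel" and vN: "\<And>x. N (v x) \<le> 1"
    and vG: "\<And>x. (1 - \<delta>) * D x \<le> v x \<bullet> G x"
    using dual_norm_selection[OF N c G_meas \<delta>(1)] unfolding D_def by blast
  define \<tau> where "\<tau> x = x + (\<delta> * s x) *\<^sub>R v x" for x
  have \<tau> [measurable]: "\<tau> \<in> \<mu> \<rightarrow>\<^sub>M borel" unfolding \<tau>_def by measurable
  define \<pi> where "\<pi> = distr \<mu> (borel \<Otimes>\<^sub>M borel) (\<lambda>x. (x, \<tau> x))"
  define \<nu> where "\<nu> = distr \<mu> borel \<tau>"
  have pair [measurable]: "(\<lambda>x. (x, \<tau> x)) \<in> \<mu> \<rightarrow>\<^sub>M borel \<Otimes>\<^sub>M borel" by measurable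
  have \<pi>: "\<pi> \<in> couplings \<mu> \<nu>"
    unfolding couplings_def \<pi>_def \<nu>_def
    by (auto simp: distr_distr comp_def distr_id2)
  have "Lp_seminorm p \<pi> (\<lambda>(x, y). N (x - y)) \<le> Lp_seminorm p \<mu> (\<lambda>x. (\<lambda>(x, y). N (x - y)) (x, \<tau> x))"
    unfolding \<pi>_def by (rule Lp_seminorm_distr_le[OF pair]) measurable
  also have "\<dots> \<le> ennreal \<delta>"
  proof (rule sLp)
    show "(\<lambda>x. case (x, \<tau> x) of (x, y) \<Rightarrow> N (x - y)) \<in> borel_measurable \<mu>" by simp
    fix x
    have "N (x - \<tau> x) = N (- ((\<delta> * s x) *\<^sub>R v x))" by (simp add: \<tau>_def)
    also have "\<dots> = \<delta> * s x * N (v x)"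
      unfolding is_norm_minus[OF N] using N \<delta> s0[of x] by (simp add: is_norm_def)
    also have "\<dots> \<le> \<delta> * s x" using vN[of x] \<delta> s0[of x] by (simp add: mult_left_le)
    finally show "\<bar>case (x, \<tau> x) of (x, y) \<Rightarrow> N (x - y)\<bar> \<le> \<delta> * s x" using N_nonneg by simp
  qed (use \<delta> in simp)
  finally have le: "Lp_seminorm p \<pi> (\<lambda>(x, y). N (x - y)) \<le> ennreal \<delta>" .
  note ce = coupling_expansion[OF \<pi> \<delta>(1) le]
  have "\<delta> * (1 - \<delta>) * slope \<le> (\<integral>z. G (fst z) \<bullet> (snd z - fst z) \<partial>\<pi>)"
  proof -
    \<comment> \<open>The step length \<open>s\<close> may be unbounded for a general witness; its
      product with the gain is dominated by \<open>s x * D x\<close>, whose integrability came with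
      the witness.\<close>
    have i: "integrable \<mu> (\<lambda>x. \<delta> * s x * (v x \<bullet> G x))"
    proof (rule Bochner_Integration.integrable_bound[of \<mu> "\<lambda>x. \<delta> * (s x * D x)"])
      show "integrable \<mu> (\<lambda>x. \<delta> * (s x * D x))" using sD by simp
      have "\<bar>v x \<bullet> G x\<bar> \<le> D x" for x
        using inner_le_dual_norm[OF N c, of "v x" "G x"] mult_right_mono[OF vN[of x] D_nonneg[of x]]
        by (simp add: D_def)
      then have "\<bar>s x\<bar> * \<bar>v x \<bullet> G x\<bar> \<le> \<bar>s x\<bar> * \<bar>D x\<bar>" for x
        using D_nonneg by (intro mult_left_mono) auto
      then show "AE x in \<mu>. norm (\<delta> * s x * (v x \<bullet> G x)) \<le> norm (\<delta> * (s x * D x))"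
        using \<delta> by (auto simp: abs_mult mult.assoc intro!: mult_left_mono)
    qed measurable
    have "\<delta> * (1 - \<delta>) * slope = (\<integral>x. \<delta> * (1 - \<delta>) * (s x * D x) \<partial>\<mu>)" by (simp add: sD(2))
    also have "\<dots> \<le> (\<integral>x. \<delta> * s x * (v x \<bullet> G x) \<partial>\<mu>)"
    proof (rule integral_mono)
      fix x
      have "(\<delta> * s x) * ((1 - \<delta>) * D x) \<le> (\<delta> * s x) * (v x \<bullet> G x)"
        using vG[of x] \<delta> s0[of x] by (intro mult_left_mono) auto
      then show "\<delta> * (1 - \<delta>) * (s x * D x) \<le> \<delta> * s x * (v x \<bullet> G x)" by (simp add: mult_ac)
    qed (use sD i in auto)
    also have "\<dots> = (\<integral>z. G (fst z) \<bullet> (snd z - fst z) \<partial>\<pi>)"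
      unfolding \<pi>_def by (subst integral_distr[OF pair]) (auto simp: \<tau>_def inner_commute)
    finally show ?thesis .
  qed
  moreover have "\<delta> * (1 - \<delta>) * slope = \<delta> * slope - slope * \<delta>\<^sup>2"
    by (simp add: algebra_simps power2_eq_square)
  moreover have "slope * \<delta>\<^sup>2 \<le> C / c * \<delta>\<^sup>2" using slope_le by (intro mult_right_mono) auto
  ultimately have "(\<integral>x. j x \<partial>\<mu>) + \<delta> * slope - (C / c + K) * \<delta>\<^sup>2 \<le> (\<integral>y. j y \<partial>\<nu>)"
    using ce(1) unfolding distrib_right[of "C / c" K] by linarith
  moreover have "\<nu> \<in> wasserstein_ball p N \<mu> \<delta>"
  proof -
    have "borel_prob \<nu>" unfolding borel_prob_def \<nu>_def using \<mu>.prob_space_distr[OF \<tau>] by simp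
    moreover have "wasserstein p N \<mu> \<nu> \<le> ennreal \<delta>"
      unfolding wasserstein_def using \<pi> le by (rule INF_lower2)
    ultimately show ?thesis by (simp add: wasserstein_ball_def)
  qed
  ultimately show thesis using that by blast
qed

end

section \<open>From one control to suprema, infima and the control problem\<close>

lemma quadratic_expansion_worst_case:
  assumes "quadratic_expansion p q N \<mu> (\<lambda>x. j x \<theta>) (gradient (\<lambda>x. j x \<theta>)) c C R" and \<delta>: "0 < \<delta>" "\<delta> < 1"
  shows "\<bar>worst_case_cost p N j \<mu> \<delta> \<theta> - ereal (first_order_cost q N j \<mu> \<delta> \<theta>)\<bar>
           \<le> ereal ((C / c + 4 * (C / c\<^sup>2)) * \<delta>\<^sup>2)"
proof -
  interpret quadratic_expansion p q N \<mu> "\<lambda>x. j x \<theta>" "gradient (\<lambda>x. j x \<theta>)" c C R by (rule assms(1))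
  let ?F = "first_order_cost q N j \<mu> \<delta> \<theta>" and ?W = "worst_case_cost p N j \<mu> \<delta> \<theta>" and ?e = "(C / c + 4 * K) * \<delta>\<^sup>2"
  have F: "?F = (\<integral>x. j x \<theta> \<partial>\<mu>) + \<delta> * slope"
    by (simp add: first_order_cost_def expected_cost_def slope_def D_def)
  have 1: "?W \<le> ereal (?F + ?e)"
    unfolding worst_case_cost_def
  proof (rule SUP_least)
    fix \<nu> assume "\<nu> \<in> wasserstein_ball p N \<mu> \<delta>"
    then show "ereal (expected_cost j \<nu> \<theta>) \<le> ereal (?F + ?e)"
      using worst_case_upper[OF \<delta>(1) less_imp_le[OF \<delta>(2)]] by (simp add: F expected_cost_def)
  qed
  obtain \<nu> where \<nu>: "\<nu> \<in> wasserstein_ball p N \<mu> \<delta>"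
      "(\<integral>x. j x \<theta> \<partial>\<mu>) + \<delta> * slope - (C / c + K) * \<delta>\<^sup>2 \<le> (\<integral>y. j y \<theta> \<partial>\<nu>)"
    using worst_case_lower[OF \<delta>] by blast
  \<comment> \<open>The lower bound has the smaller error constant, so the upper one serves for both
    sides. It contains only \<open>C\<close> and \<open>c\<close>, hence is the same for all
    controls that share them.\<close>
  have "(C / c + K) * \<delta>\<^sup>2 \<le> ?e" using K_nonneg by (intro mult_right_mono) auto
  then have "ereal (?F - ?e) \<le> ereal (expected_cost j \<nu> \<theta>)"
    using \<nu>(2) by (simp add: F expected_cost_def)
  also have "\<dots> \<le> ?W" unfolding worst_case_cost_def by (rule SUP_upper[OF \<nu>(1)])
  finally have 2: "ereal (?F - ?e) \<le> ?W" .
  show ?thesis using 1 2 by (cases ?W) (auto simp: K_def)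
qed

text \<open>A uniform error passes to infima. Subtracting the finite number \<open>e\<close> remains
  meaningful when an infimum is \<open>-\<infinity>\<close>, or \<open>\<infinity>\<close> for empty
  \<open>I\<close>, which is why the two sides are compared by two inequalities instead of a
  difference.\<close>

lemma ereal_close_INF:
  assumes "\<And>i. i \<in> I \<Longrightarrow> \<bar>a i - ereal (b i)\<bar> \<le> ereal e"
  shows "ereal_close e (INF i\<in>I. a i) (INF i\<in>I. ereal (b i))"
proof -
  have ab: "a i - ereal e \<le> ereal (b i)" "ereal (b i) - ereal e \<le> a i" if "i \<in> I" for i
    using assms[OF that] by (cases "a i"; auto)+
  have "(INF i\<in>I. a i) - ereal e \<le> (INF i\<in>I. ereal (b i))"
  proof (rule INF_greatest)
    fix i assume i: "i \<in> I"
    show "(INF i\<in>I. a i) - ereal e \<le> ereal (b i)"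
      using ereal_minus_mono[OF INF_lower[OF i, of a] order_refl[of "ereal e"]] ab(1)[OF i] by (rule order_trans)
  qed
  moreover have "(INF i\<in>I. ereal (b i)) - ereal e \<le> (INF i\<in>I. a i)"
  proof (rule INF_greatest)
    fix i assume i: "i \<in> I"
    show "(INF i\<in>I. ereal (b i)) - ereal e \<le> a i"
      using ereal_minus_mono[OF INF_lower[OF i, of "\<lambda>i. ereal (b i)"] order_refl[of "ereal e"]] ab(2)[OF i] by (rule order_trans)
  qed
  ultimately show ?thesis by (simp add: ereal_close_def ereal_minus_le)
qed

text \<open>Each coordinate is a pointwise limit of difference quotients with step
  \<open>1 / Suc n\<close>, so measurability follows from differentiability alone, without
  continuity of the gradient.\<close>

lemma gradient_measurable:
  fixes g :: "'a::euclidean_space \<Rightarrow> real"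
  assumes g [measurable]: "g \<in> borel_measurable borel" and G: "\<And>x. GDERIV g x :> gradient g x"
  shows "gradient g \<in> borel_measurable borel"
proof (subst borel_measurable_euclidean_space, intro ballI)
  fix b :: 'a assume b: "b \<in> Basis"
  have "(\<lambda>n. (g (x + (1 / Suc n) *\<^sub>R b) - g x) / (1 / Suc n)) \<longlonglongrightarrow> gradient g x \<bullet> b" for x
  proof -
    have "((\<lambda>t. g (x + t *\<^sub>R b)) has_derivative (\<lambda>t. (t *\<^sub>R b) \<bullet> gradient g x)) (at 0)"
      using G[of x] unfolding gderiv_def
      by (intro has_derivative_compose[of "\<lambda>t. x + t *\<^sub>R b" _ 0 UNIV g]) (auto intro!: derivative_eq_intros)
    then have "((\<lambda>t. g (x + t *\<^sub>R b)) has_field_derivative (gradient g x \<bullet> b)) (at 0)"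
      by (simp add: has_field_derivative_def inner_commute mult.commute[of "b \<bullet> gradient g x"] mult_commute_abs)
    then have "((\<lambda>t. (g (x + t *\<^sub>R b) - g x) / t) \<longlongrightarrow> gradient g x \<bullet> b) (at 0)"
      by (simp add: has_field_derivative_iff)
    moreover have "filterlim (\<lambda>n. 1 / real (Suc n)) (at 0) sequentially"
      unfolding filterlim_at using LIMSEQ_inverse_real_of_nat by (auto simp: inverse_eq_divide)
    ultimately show ?thesis by (rule filterlim_compose)
  qed
  then show "(\<lambda>x. gradient g x \<bullet> b) \<in> borel_measurable borel"
    by (rule borel_measurable_LIMSEQ_real) measurable
qed

theorem theorem1p9:
  fixes T :: real
    and \<Theta>\<^sub>0 :: "'m::real_normed_vector set"
    and \<Theta> :: "(real \<Rightarrow> 'm) set"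
    and f :: "real ^ 'd \<Rightarrow> 'm \<Rightarrow> real ^ 'd"
    and \<Phi> \<l> :: "real ^ 'd \<Rightarrow> 'm \<Rightarrow> real"
    and X :: "(real \<Rightarrow> 'm) \<Rightarrow> real ^ 'd \<Rightarrow> real \<Rightarrow> real ^ 'd"
    and j :: "real ^ 'd \<Rightarrow> (real \<Rightarrow> 'm) \<Rightarrow> real"
    and \<mu>\<^sub>0 :: "(real ^ 'd) measure"
    and N :: "real ^ 'd \<Rightarrow> real"
    and p q :: ennreal
  assumes T: "0 < T"
    and exponents: "2 \<le> p" "1 / p + 1 / q = 1"
    and norm: "is_norm N"
    and controls: "\<And>\<theta>. \<theta> \<in> \<Theta> \<Longrightarrow> \<theta> \<in> borel_measurable (lebesgue_on {0..T})"
                  "\<And>\<theta> t. \<theta> \<in> \<Theta> \<Longrightarrow> t \<in> {0..T} \<Longrightarrow> \<theta> t \<in> \<Theta>\<^sub>0"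
    and f_bounded: "\<exists>B. \<forall>\<xi>. \<forall>u\<in>\<Theta>\<^sub>0. norm (f \<xi> u) \<le> B"
    and continuous_in_param: "\<And>\<xi>. continuous_on \<Theta>\<^sub>0 (f \<xi>)" "\<And>\<xi>. continuous_on \<Theta>\<^sub>0 (\<Phi> \<xi>)"
    and C1_Lipschitz: "uniformly_C1_Lipschitz \<Theta>\<^sub>0 f" "uniformly_C1_Lipschitz \<Theta>\<^sub>0 \<Phi>"
                      "uniformly_C1_Lipschitz \<Theta>\<^sub>0 \<l>"
    and gradients_bounded_in_param: "bounded ((\<lambda>u. gradient (\<lambda>\<xi>. \<Phi> \<xi> u) 0) ` \<Theta>\<^sub>0)"
                                    "bounded ((\<lambda>u. gradient (\<lambda>\<xi>. \<l> \<xi> u) 0) ` \<Theta>\<^sub>0)"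
    and terminal_C1_in_param: "\<And>\<xi>. C1_on \<Theta>\<^sub>0 (\<l> \<xi>)"
    and initial: "borel_prob \<mu>\<^sub>0" "bounded (measure_support \<mu>\<^sub>0)"
    and C2: "\<And>u. u \<in> \<Theta>\<^sub>0 \<Longrightarrow> C2_on UNIV (\<lambda>\<xi>. f \<xi> u)"
            "\<And>u. u \<in> \<Theta>\<^sub>0 \<Longrightarrow> C2_on UNIV (\<lambda>\<xi>. \<Phi> \<xi> u)"
            "\<And>u. u \<in> \<Theta>\<^sub>0 \<Longrightarrow> C2_on UNIV (\<lambda>\<xi>. \<l> \<xi> u)"
    and X: "\<And>\<theta> x. \<theta> \<in> \<Theta> \<Longrightarrow> ode_solution T f \<theta> x (X \<theta> x)"
    and j: "j = cost T \<Phi> \<l> X"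
  shows "(\<exists>C. \<forall>\<^sub>F \<delta> in at_right 0. \<forall>\<theta>\<in>\<Theta>.
            \<bar>worst_case_cost p N j \<mu>\<^sub>0 \<delta> \<theta> - ereal (first_order_cost q N j \<mu>\<^sub>0 \<delta> \<theta>)\<bar>
              \<le> ereal (C * \<delta>\<^sup>2)) \<and>
         (\<exists>C. \<forall>\<^sub>F \<delta> in at_right 0.
            ereal_close (C * \<delta>\<^sup>2) (robust_value p N j \<mu>\<^sub>0 \<Theta> \<delta>) (first_order_value q N j \<mu>\<^sub>0 \<Theta> \<delta>))"
proof -
  have prob: "prob_space \<mu>\<^sub>0" and sets: "sets \<mu>\<^sub>0 = sets borel"
    using initial(1) by (auto simp: borel_prob_def)
  obtain R where R: "\<And>x. x \<in> measure_support \<mu>\<^sub>0 \<Longrightarrow> norm x \<le> R"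
    using initial(2) by (auto simp: bounded_iff)
  have supp: "AE x in \<mu>\<^sub>0. norm x \<le> R"
    using AE_measure_support[OF sets] by eventually_elim (rule R)
  obtain c where c: "0 < c" "\<And>x. c * norm x \<le> N x" using is_norm_lower[OF norm] by blast
  \<comment> \<open>Stated for every radius: the radius of the support gives the constant of the
    expansion, whereas differentiability at an arbitrary point \<open>x\<close> uses the radius
    \<open>norm x\<close>.\<close>
  have regular: "\<exists>C\<ge>0. \<forall>\<theta>\<in>\<Theta>. \<forall>x. norm x \<le> R \<longrightarrow>
      (\<forall>a b. \<forall>s\<in>{0..1}. \<bar>(1 - s) * j a \<theta> + s * j b \<theta> - j ((1 - s) *\<^sub>R a + s *\<^sub>R b) \<theta>\<bar>
         \<le> C * ((norm (a - x))\<^sup>2 + (norm (b - x))\<^sup>2)) \<and>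
      (\<forall>a. \<bar>j a \<theta> - j x \<theta>\<bar> \<le> C * (norm (a - x) + (norm (a - x))\<^sup>2))" for R
    unfolding j
    by (rule cost_regularity[of T \<Theta> \<Theta>\<^sub>0 f \<Phi> \<l> X R])
      (use T controls f_bounded continuous_in_param C1_Lipschitz gradients_bounded_in_param X in blast)+
  have expand: "(\<forall>y. \<bar>j y \<theta> - j x \<theta> - gradient (\<lambda>x. j x \<theta>) x \<bullet> (y - x)\<bar> \<le> 4 * C * (norm (y - x))\<^sup>2) \<and>
      norm (gradient (\<lambda>x. j x \<theta>) x) \<le> C \<and> GDERIV (\<lambda>x. j x \<theta>) x :> gradient (\<lambda>x. j x \<theta>) x"
    if "\<And>a b s. s \<in> {0..1} \<Longrightarrow> \<bar>(1 - s) * j a \<theta> + s * j b \<theta> - j ((1 - s) *\<^sub>R a + s *\<^sub>R b) \<theta>\<bar>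
         \<le> C * ((norm (a - x))\<^sup>2 + (norm (b - x))\<^sup>2)"
      "\<And>a. \<bar>j a \<theta> - j x \<theta>\<bar> \<le> C * (norm (a - x) + (norm (a - x))\<^sup>2)" for x \<theta> C
  proof -
    note hyps = that
    obtain A where A: "\<And>y. \<bar>j y \<theta> - j x \<theta> - A \<bullet> (y - x)\<bar> \<le> 4 * C * (norm (y - x))\<^sup>2" "norm A \<le> C"
        "GDERIV (\<lambda>x. j x \<theta>) x :> A"
      by (rule gradient_of_nearly_affine[where g = "\<lambda>x. j x \<theta>", OF hyps]) blast+
    then show ?thesis by (simp add: gradient_eqI)
  qed
  \<comment> \<open>Here the constant may depend on \<open>x\<close>. Differentiability everywhere
    is what makes the cost continuous and its gradient measurable on the whole space, as the locale
    demands.\<close>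
  have deriv: "GDERIV (\<lambda>x. j x \<theta>) x :> gradient (\<lambda>x. j x \<theta>) x" if "\<theta> \<in> \<Theta>" for \<theta> x
  proof -
    obtain C where "\<forall>\<theta>\<in>\<Theta>. \<forall>y. norm y \<le> norm x \<longrightarrow>
      (\<forall>a b. \<forall>s\<in>{0..1}. \<bar>(1 - s) * j a \<theta> + s * j b \<theta> - j ((1 - s) *\<^sub>R a + s *\<^sub>R b) \<theta>\<bar>
         \<le> C * ((norm (a - y))\<^sup>2 + (norm (b - y))\<^sup>2)) \<and>
      (\<forall>a. \<bar>j a \<theta> - j y \<theta>\<bar> \<le> C * (norm (a - y) + (norm (a - y))\<^sup>2))"
      using regular[of "norm x"] by blast
    with that show ?thesis using expand[of \<theta> C x] by blast
  qed
  have cont: "continuous_on UNIV (\<lambda>x. j x \<theta>)" if "\<theta> \<in> \<Theta>" for \<theta>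
    using deriv[OF that] unfolding gderiv_def
    by (meson continuous_at_imp_continuous_on has_derivative_continuous)
  obtain C where C: "0 \<le> C" and regC: "\<forall>\<theta>\<in>\<Theta>. \<forall>x. norm x \<le> R \<longrightarrow>
      (\<forall>a b. \<forall>s\<in>{0..1}. \<bar>(1 - s) * j a \<theta> + s * j b \<theta> - j ((1 - s) *\<^sub>R a + s *\<^sub>R b) \<theta>\<bar>
         \<le> C * ((norm (a - x))\<^sup>2 + (norm (b - x))\<^sup>2)) \<and>
      (\<forall>a. \<bar>j a \<theta> - j x \<theta>\<bar> \<le> C * (norm (a - x) + (norm (a - x))\<^sup>2))"
    using regular[of R] by blast
  \<comment> \<open>The Taylor remainder has the constant \<open>4 * C\<close> and the gradient the
    bound \<open>C\<close>; the locale has a single constant for both, so the larger one is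
    used.\<close>
  have qe: "quadratic_expansion p q N \<mu>\<^sub>0 (\<lambda>x. j x \<theta>) (gradient (\<lambda>x. j x \<theta>)) c (4 * C) R" if \<theta>: "\<theta> \<in> \<Theta>" for \<theta>
  proof
    show "gradient (\<lambda>x. j x \<theta>) \<in> borel_measurable borel"
      by (intro gradient_measurable borel_measurable_continuous_onI cont deriv \<theta>)
    fix x :: "real ^ 'd" assume x: "norm x \<le> R"
    have e: "(\<forall>y. \<bar>j y \<theta> - j x \<theta> - gradient (\<lambda>x. j x \<theta>) x \<bullet> (y - x)\<bar> \<le> 4 * C * (norm (y - x))\<^sup>2) \<and>
      norm (gradient (\<lambda>x. j x \<theta>) x) \<le> C \<and> GDERIV (\<lambda>x. j x \<theta>) x :> gradient (\<lambda>x. j x \<theta>) x"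
      by (rule expand) (use regC \<theta> x in blast)+
    show "\<bar>j y \<theta> - j x \<theta> - gradient (\<lambda>x. j x \<theta>) x \<bullet> (y - x)\<bar> \<le> 4 * C * (norm (y - x))\<^sup>2" for y
      using e by blast
    show "norm (gradient (\<lambda>x. j x \<theta>) x) \<le> 4 * C" using e C by linarith
  qed (use exponents norm c initial(1) supp C cont[OF \<theta>] in auto)
  define E where "E = 4 * C / c + 4 * (4 * C / c\<^sup>2)"
  have bound: "\<bar>worst_case_cost p N j \<mu>\<^sub>0 \<delta> \<theta> - ereal (first_order_cost q N j \<mu>\<^sub>0 \<delta> \<theta>)\<bar> \<le> ereal (E * \<delta>\<^sup>2)"
    if "\<delta> \<in> {0<..<1}" "\<theta> \<in> \<Theta>" for \<delta> \<theta>
    unfolding E_def using that by (intro quadratic_expansion_worst_case[OF qe]) auto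
  have small: "\<forall>\<^sub>F \<delta> in at_right (0::real). \<delta> \<in> {0<..<1}"
    by (rule eventually_at_right_real) simp
  have "\<forall>\<^sub>F \<delta> in at_right 0. \<forall>\<theta>\<in>\<Theta>. \<bar>worst_case_cost p N j \<mu>\<^sub>0 \<delta> \<theta> - ereal (first_order_cost q N j \<mu>\<^sub>0 \<delta> \<theta>)\<bar> \<le> ereal (E * \<delta>\<^sup>2)"
    using small by eventually_elim (use bound in blast)
  moreover have "\<forall>\<^sub>F \<delta> in at_right 0. ereal_close (E * \<delta>\<^sup>2) (robust_value p N j \<mu>\<^sub>0 \<Theta> \<delta>) (first_order_value q N j \<mu>\<^sub>0 \<Theta> \<delta>)"
    using small unfolding robust_value_def first_order_value_def
    by eventually_elim (intro ereal_close_INF bound)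
  ultimately show ?thesis by blast
qed

end
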